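(* Let $1<p<\infty$. Then there exists an $\varepsilon_p>0$ such that $$\|Mf\|_{L^p(\mathbb{R})}\ge (1+\varepsilon_p)\|f\|_{L^p(\mathbb{R})}\quad \text{for any } f\in L^p(\mathbb{R}).$$ Furthermore, if $A_p$ is the best constant for the strong $(p,p)$ inequality satisfied by the centered maximal operator $M$ on the real line, and $\gamma_n:=g_n(0)$, where $g_0\equiv 0$ on $[-1/2,\infty)$ and, for $n\ge 1$, $g_n(t):=\frac{1+\int_0^{1+2t}g_{n-1}(u)\,du}{2(1+t)}$ for $t\ge -\tfrac12$, then for every $n\ge 1$ we can select $$(1+\varepsilon_p)^p=1+\left(\frac{A_p-1}{A_p^n-1}\right)^p\left[\left(\frac{\gamma_n p}{p-1}\right)^{1/p}-1\right]^p.$$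
   Context: For a locally integrable function $f:\mathbb{R}\to\mathbb{R}$, $M$ is the centered Hardy-Littlewood maximal operator on the real line, $$Mf(x)=\sup_{r>0}\frac{1}{2r}\int_{x-r}^{x+r}|f(y)|\,dy,\quad x\in\mathbb{R}.$$ $A_p$ denotes the smallest constant such that $\|Mf\|_{L^p(\mathbb{R})}\le A_p\|f\|_{L^p(\mathbb{R})}$ for all $f\in L^p(\mathbb{R})$. Define functions $g_n:[-1/2,\infty)\to[0,1]$ for integers $n\ge 0$ by $g_0\equiv 0$ and, for $n\ge 1$, $$g_n(t):=\frac{1+\int_0^{1+2t}g_{n-1}(u)\,du}{2(1+t)},\quad t\ge -\tfrac12.$$ For each integer $n\ge 1$ set $\gamma_n:=g_n(0)$.
   Formalization: The formula for ε_p is asserted only for n with γ_n p/(p−1) ≥ 1 (ε_p > 0 when strict, ε_p = 0 at equality), which is shown to hold strictly for all large n; otherwise the bracket is negative and the claim fails, e.g. n = 1, p = 3. *)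

theory Defs
  imports "HOL-Analysis.Analysis"
begin

text \<open>Real powers on \<open>[0,\<infinity>]\<close>. The value at \<open>\<infinity>\<close> is the intended one only for
  exponents \<open>a > 0\<close>; only \<open>a = p\<close> and \<open>a = 1/p\<close> with \<open>p > 1\<close> occur below.\<close>

definition ennreal_powr :: "ennreal \<Rightarrow> real \<Rightarrow> ennreal" where
  "ennreal_powr x a = (if x = \<infinity> then \<infinity> else ennreal (enn2real x powr a))"

definition Lp_enorm :: "real \<Rightarrow> (real \<Rightarrow> ennreal) \<Rightarrow> ennreal" where
  "Lp_enorm p F = ennreal_powr (\<integral>\<^sup>+ x. ennreal_powr (F x) p \<partial>lebesgue) (1 / p)"

definition Lp_norm :: "real \<Rightarrow> (real \<Rightarrow> real) \<Rightarrow> ennreal" where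
  "Lp_norm p f = Lp_enorm p (\<lambda>x. ennreal \<bar>f x\<bar>)"

definition Lp_space :: "real \<Rightarrow> (real \<Rightarrow> real) set" where
  "Lp_space p = {f. f \<in> borel_measurable lebesgue \<and> Lp_norm p f < \<infinity>}"

text \<open>The maximal function takes values in \<open>[0,\<infinity>]\<close>, since the supremum may be infinite
  at some points.\<close>

definition centered_maximal :: "(real \<Rightarrow> real) \<Rightarrow> real \<Rightarrow> ennreal" where
  "centered_maximal f x =
     (SUP r\<in>{0<..}. (\<integral>\<^sup>+ y\<in>{x - r..x + r}. ennreal \<bar>f y\<bar> \<partial>lebesgue) / ennreal (2 * r))"

definition strong_type_constant :: "real \<Rightarrow> real \<Rightarrow> bool" where
  "strong_type_constant p C \<longleftrightarrow>
     0 \<le> C \<and> (\<forall>f\<in>Lp_space p. Lp_enorm p (centered_maximal f) \<le> ennreal C * Lp_norm p f)"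

text \<open>Admissible constants form a closed set that is bounded below, and it is nonempty for
  \<open>p > 1\<close> by the Hardy--Littlewood maximal theorem, so the infimum is the smallest one.\<close>

definition best_constant :: "real \<Rightarrow> real" where
  "best_constant p = Inf {C. strong_type_constant p C}"

text \<open>\<open>g_seq n t\<close> is meaningful only for \<open>t \<ge> -1/2\<close>; for such \<open>t\<close> the recursion refers to
  \<open>g_seq (n - 1)\<close> on \<open>[0, 1 + 2t]\<close> only.\<close>

primrec g_seq :: "nat \<Rightarrow> real \<Rightarrow> real" where
  "g_seq 0 = (\<lambda>t. 0)"
| "g_seq (Suc n) = (\<lambda>t. (1 + integral {0..1 + 2 * t} (g_seq n)) / (2 * (1 + t)))"

definition gamma_seq :: "nat \<Rightarrow> real" where
  "gamma_seq n = g_seq n 0"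

end

theory Submission
  imports Defs
begin

text \<open>
Write \<open>M\<close> for the centered maximal operator and \<open>A\<close> for its best constant on \<open>L\<^sup>p\<close>. Since \<open>M f \<ge> |f|\<close>
almost everywhere, \<open>M f = |f| + H\<close> with \<open>H \<ge> 0\<close>, and \<open>\<parallel>M f\<parallel>\<^sup>p \<ge> \<parallel>f\<parallel>\<^sup>p + \<parallel>H\<parallel>\<^sup>p\<close>. It remains to see that
\<open>H\<close> cannot be small. If it were, sublinearity would keep every iterate close to \<open>f\<close>: each step
multiplies an increment at most by \<open>A\<close> in norm, whence
\<open>\<parallel>M\<^sup>n f\<parallel> \<le> \<parallel>f\<parallel> + (A\<^sup>n - 1) / (A - 1) * \<parallel>H\<parallel>\<close>. Iterates, however, do increase the norm by a definite
factor, \<open>\<parallel>M\<^sup>n f\<parallel>\<^sup>p \<ge> \<gamma>\<^sub>n p / (p - 1) * \<parallel>f\<parallel>\<^sup>p\<close> (lemma \<open>hl_iter_Lp_lower_bound\<close>). Solving for \<open>\<parallel>H\<parallel>\<close>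
gives the stated \<open>\<epsilon>\<close> (lemma \<open>Lp_enorm_hl_max_ge\<close>).

The lower bound for iterates is a reverse weak type inequality,
\<open>l * |{M\<^sup>n f > l}| \<ge> \<gamma>\<^sub>n * \<integral>\<^bsub>f > l\<^esub> f\<close> for \<open>f \<ge> 0\<close> (lemma \<open>level_set_lower_bound\<close>), integrated against
\<open>p l\<^sup>p\<^sup>-\<^sup>2\<close>. For the uncentered operator such an inequality comes from the rising sun lemma, which
provides intervals with mean \<open>\<nu>\<close>. The centered operator loses at the ends of such an interval, but
its iterates win most of this back: \<open>g\<^sub>n t\<close> is by construction a lower bound for \<open>M\<^sup>n f / \<nu>\<close> at relative
distance \<open>t\<close> from an interval with mean \<open>\<nu>\<close> (lemma \<open>hl_iter_ge_g_seq\<close>), so \<open>\<gamma>\<^sub>n = g\<^sub>n 0\<close> is the factor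
that survives at an end point.

Finally \<open>\<gamma>\<^sub>n\<close> tends to 1 (lemma \<open>g_seq_deficit\<close>), so \<open>\<gamma>\<^sub>n p / (p - 1)\<close> exceeds 1 for large \<open>n\<close>. This makes
\<open>\<epsilon>\<close> positive and also shows \<open>A > 1\<close>. That finite constants are admissible at all is the maximal
theorem, obtained from Vitali's covering lemma and truncation (lemma \<open>hl_max_Lp_upper_bound\<close>).
\<close>

section \<open>The numbers \<open>\<gamma>\<^sub>n\<close> tend to 1\<close>

lemma g_seq_continuous_nonneg:
  "continuous_on {0..} (g_seq n) \<and> (\<forall>t\<ge>0. 0 \<le> g_seq n t)"
proof (induction n)
  case 0
  then show ?case by simp
next
  case (Suc n)
  have int: "g_seq n integrable_on {a..b}" if "0 \<le> a" for a b
    using Suc that by (intro integrable_continuous_interval) (auto intro: continuous_on_subset)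
  have cont: "continuous_on {0..} (\<lambda>t. integral {0..t} (g_seq n))"
    unfolding continuous_on_eq_continuous_within
  proof
    fix x :: real assume "x \<in> {0..}"
    have "continuous_on {0..x + 1} (\<lambda>t. integral {0..t} (g_seq n))"
      by (intro indefinite_integral_continuous_1 int) simp
    then have "continuous (at x within {0..x + 1}) (\<lambda>t. integral {0..t} (g_seq n))"
      using \<open>x \<in> {0..}\<close> by (auto simp: continuous_on_eq_continuous_within)
    moreover have "at x within {0..x + 1} = at x within {0..}"
      by (rule at_within_nhd[of _ "{..<x + 1}"]) auto
    ultimately show "continuous (at x within {0..}) (\<lambda>t. integral {0..t} (g_seq n))"
      by simp
  qed
  have "continuous_on {0..} (\<lambda>t. integral {0..1 + 2 * t} (g_seq n))"
    by (rule continuous_on_compose2[OF cont, where f = "\<lambda>t. 1 + 2 * t"])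
       (auto intro!: continuous_intros)
  then have "continuous_on {0..} (g_seq (Suc n))"
    by (auto intro!: continuous_intros)
  moreover have "0 \<le> integral {0..1 + 2 * t} (g_seq n)" for t
    using Suc by (intro integral_nonneg int) auto
  ultimately show ?case
    by (auto intro!: divide_nonneg_nonneg add_nonneg_nonneg)
qed

lemma g_seq_integrable: "0 \<le> a \<Longrightarrow> g_seq n integrable_on {a..b}"
  using g_seq_continuous_nonneg[of n]
  by (intro integrable_continuous_interval) (auto intro: continuous_on_subset)

text \<open>The constant function 1 solves the recursion of \<open>g_seq\<close>, so the deficit \<open>h\<^sub>n = 1 - g\<^sub>n\<close> obeys the
homogeneous recursion \<open>2(1 + t) h\<^sub>n\<^sub>+\<^sub>1(t) = \<integral>\<^bsub>[0, 1+2t]\<^esub> h\<^sub>n\<close>. In probabilistic terms \<open>h\<^sub>n(t)\<close> is the chance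
that a walk started at \<open>Y = 1 + t\<close>, multiplied at each step by an independent uniform variable on
\<open>(0, 2)\<close>, has not dropped below 1 after \<open>n\<close> steps. The function \<open>sqrt Y\<close> is a strict supermartingale
for this walk: a step multiplies its mean by \<open>2 * sqrt 2 / 3 < 1\<close>, which gives the geometric decay.\<close>
lemma g_seq_deficit:
  assumes "0 \<le> t"
  shows "1 - g_seq n t \<le> (sqrt 2 * 2 / 3) ^ n * sqrt (1 + t)"
  using assms
proof (induction n arbitrary: t)
  case 0
  then show ?case by simp
next
  case (Suc n)
  let ?q = "sqrt 2 * 2 / 3 :: real"
  have ftc: "((\<lambda>u. sqrt (1 + u)) has_integral (2/3) * (2 + 2*t) * sqrt (2 + 2*t)) {-1..1 + 2*t}"
  proof -
    have "((\<lambda>u. sqrt (1 + u)) has_integral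
        (2/3) * (1 + (1 + 2*t)) * sqrt (1 + (1 + 2*t)) - (2/3) * (1 + -1) * sqrt (1 + -1)) {-1..1 + 2*t}"
    proof (rule fundamental_theorem_of_calculus_interior)
      show "continuous_on {-1..1 + 2*t} (\<lambda>u. (2/3) * (1 + u) * sqrt (1 + u))"
        by (intro continuous_intros)
      show "((\<lambda>u. (2/3) * (1 + u) * sqrt (1 + u)) has_vector_derivative sqrt (1 + u)) (at u)"
        if "u \<in> {-1<..<1 + 2*t}" for u
      proof -
        have "sqrt (1 + u) * (sqrt (1 + u) * 9) = 9 + u * 9"
          using that by (simp flip: mult.assoc)
        then show ?thesis
          unfolding has_real_derivative_iff_has_vector_derivative[symmetric]
          using that by (auto intro!: derivative_eq_intros simp: field_simps)
      qed
    qed (use Suc in auto)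
    then show ?thesis by (simp add: algebra_simps)
  qed
  have int0: "(\<lambda>u. sqrt (1 + u)) integrable_on {0..1 + 2*t}"
    using ftc by (rule integrable_on_subinterval[OF has_integral_integrable]) auto
  \<comment> \<open>The lower limit 0 is moved to \<open>-1\<close> below: the integral from \<open>-1\<close> is an exact multiple of \<open>(1 + t) * sqrt (1 + t)\<close>.\<close>
  have "1 + 2*t - integral {0..1 + 2*t} (g_seq n) = integral {0..1 + 2*t} (\<lambda>u. 1 - g_seq n u)"
    using Suc.prems by (subst integral_diff) (auto intro!: g_seq_integrable)
  also have "\<dots> \<le> integral {0..1 + 2*t} (\<lambda>u. ?q ^ n * sqrt (1 + u))"
    by (intro integral_le Suc.IH integrable_diff g_seq_integrable integrable_on_mult_right int0) auto
  also have "\<dots> = ?q ^ n * integral {0..1 + 2*t} (\<lambda>u. sqrt (1 + u))"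
    by simp
  also have "integral {0..1 + 2*t} (\<lambda>u. sqrt (1 + u)) \<le> integral {-1..1 + 2*t} (\<lambda>u. sqrt (1 + u))"
    using ftc by (intro integral_subset_le int0) auto
  also have "\<dots> = (2/3) * (2 + 2*t) * sqrt (2 + 2*t)"
    using ftc by (rule integral_unique)
  also have "\<dots> = (?q * sqrt (1 + t)) * (2 * (1 + t))"
    using real_sqrt_mult[of 2 "1 + t"] by (simp add: algebra_simps)
  finally have "1 + 2*t - integral {0..1 + 2*t} (g_seq n) \<le> ?q ^ n * ((?q * sqrt (1 + t)) * (2 * (1 + t)))"
    by (simp add: mult_left_mono)
  moreover have "1 - g_seq (Suc n) t = (1 + 2*t - integral {0..1 + 2*t} (g_seq n)) / (2 * (1 + t))"
    using Suc.prems by (simp add: field_simps)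
  ultimately show ?case
    using Suc.prems by (simp add: divide_le_eq mult_ac)
qed

lemma gamma_seq_nonneg: "0 \<le> gamma_seq n"
  using g_seq_continuous_nonneg[of n] by (simp add: gamma_seq_def)

lemma eventually_gamma_seq_greater:
  assumes "c < 1"
  shows "\<forall>\<^sub>F n in sequentially. c < gamma_seq n"
proof -
  have "sqrt 2 < sqrt ((3/2)^2)"
    by (subst real_sqrt_less_iff) (simp add: power2_eq_square)
  then have "(\<lambda>n. (sqrt 2 * 2 / 3) ^ n) \<longlonglongrightarrow> (0::real)"
    by (intro LIMSEQ_power_zero) simp
  with assms have "\<forall>\<^sub>F n in sequentially. (sqrt 2 * 2 / 3) ^ n < 1 - c"
    by (intro order_tendstoD(2)[where y = 0]) auto
  then show ?thesis
  proof eventually_elim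
    case (elim n)
    then show ?case using g_seq_deficit[of 0 n] by (simp add: gamma_seq_def)
  qed
qed

section \<open>Powers and \<open>L\<^sup>p\<close> norms on the extended half-line\<close>

lemma ennreal_powr_ennreal [simp]: "0 \<le> x \<Longrightarrow> ennreal_powr (ennreal x) a = ennreal (x powr a)"
  by (simp add: ennreal_powr_def)

lemma ennreal_powr_top [simp]: "ennreal_powr top a = top"
  by (simp add: ennreal_powr_def)

lemma ennreal_powr_0 [simp]: "ennreal_powr 0 a = 0"
  by (simp add: ennreal_powr_def)

lemma ennreal_powr_eq_top_iff [simp]: "ennreal_powr x a = top \<longleftrightarrow> x = top"
  by (simp add: ennreal_powr_def)

lemma borel_measurable_ennreal_powr [measurable]:
  assumes [measurable]: "F \<in> borel_measurable M"
  shows "(\<lambda>x. ennreal_powr (F x) a) \<in> borel_measurable M"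
  unfolding ennreal_powr_def by measurable

lemma ennreal_powr_mono: "0 \<le> a \<Longrightarrow> x \<le> y \<Longrightarrow> ennreal_powr x a \<le> ennreal_powr y a"
  by (cases x; cases y) (auto intro!: powr_mono2 simp: top_unique)

lemma ennreal_powr_powr: "ennreal_powr (ennreal_powr x a) b = ennreal_powr x (a * b)"
  by (cases x) (auto simp: powr_powr)

lemma ennreal_powr_1 [simp]: "ennreal_powr x 1 = x"
  by (cases x) auto

lemma ennreal_powr_mult: "ennreal_powr (x * y) a = ennreal_powr x a * ennreal_powr y a"
  by (cases x; cases y)
     (auto simp: powr_mult ennreal_top_mult ennreal_mult_top ennreal_eq_0_iff simp flip: ennreal_mult)

lemma ennreal_mult_powr: "x * ennreal_powr x a = ennreal_powr x (1 + a)"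
  by (cases x) (auto simp: powr_mult_base simp flip: ennreal_mult)

text \<open>Both powers on the left contain a factor to the power \<open>p - 1\<close>, which only grows when replaced by
\<open>(x + y) powr (p - 1)\<close>. Integrated, this is the inequality \<open>\<parallel>F + H\<parallel>\<^sup>p \<ge> \<parallel>F\<parallel>\<^sup>p + \<parallel>H\<parallel>\<^sup>p\<close> by which a
lower bound on \<open>M f - f\<close> improves the trivial bound \<open>\<parallel>M f\<parallel> \<ge> \<parallel>f\<parallel>\<close>.\<close>
lemma ennreal_powr_add_superadditive:
  assumes "1 \<le> p"
  shows "ennreal_powr x p + ennreal_powr y p \<le> ennreal_powr (x + y) p"
proof (cases x; cases y)
  fix a b assume ab: "x = ennreal a" "0 \<le> a" "y = ennreal b" "0 \<le> b"
  have "a powr p + b powr p \<le> (a + b) powr p"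
  proof (cases "a + b = 0")
    case True
    then have "a = 0" "b = 0" using ab by auto
    then show ?thesis by simp
  next
    case False
    then have pos: "0 < a + b" using ab by simp
    have "a powr p + b powr p = a * a powr (p - 1) + b * b powr (p - 1)"
      using ab by (simp add: powr_mult_base)
    also have "\<dots> \<le> a * (a + b) powr (p - 1) + b * (a + b) powr (p - 1)"
      using ab assms by (intro add_mono mult_left_mono powr_mono2) auto
    also have "\<dots> = (a + b) powr p"
      using ab powr_mult_base[of "a + b" "p - 1"] by (simp add: distrib_right)
    finally show ?thesis .
  qed
  then show ?thesis using ab by (simp flip: ennreal_plus)
qed auto

text \<open>Convexity of \<open>z \<mapsto> z powr p\<close> for the weights \<open>a / (a + b)\<close> and \<open>b / (a + b)\<close>. With \<open>a\<close>, \<open>b\<close> the norms of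
two functions, the integrated right-hand side is exactly \<open>(a + b) powr p\<close>, which is Minkowski's
inequality.\<close>
lemma ennreal_powr_add_convex:
  assumes p: "1 \<le> p" and ab: "0 < a" "0 < b"
  shows "ennreal_powr (x + y) p \<le> ennreal (((a + b) / a) powr (p - 1)) * ennreal_powr x p
       + ennreal (((a + b) / b) powr (p - 1)) * ennreal_powr y p"
proof (cases "x = top \<or> y = top")
  case True
  then show ?thesis using ab by (auto simp: ennreal_mult_top)
next
  case False
  then obtain u v where uv: "x = ennreal u" "0 \<le> u" "y = ennreal v" "0 \<le> v"
    by (cases x; cases y) auto
  let ?s = "a + b"
  have ge1: "1 \<le> (?s / a) powr (p - 1)" "1 \<le> (?s / b) powr (p - 1)"
    using ab p by (auto intro!: ge_one_powr_ge_zero)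
  \<comment> \<open>Convexity is applied on the open half-line, so a vanishing summand is treated separately.\<close>
  have "(u + v) powr p \<le> (?s / a) powr (p - 1) * u powr p + (?s / b) powr (p - 1) * v powr p"
  proof (cases "u = 0 \<or> v = 0")
    case True
    then show ?thesis
      using mult_right_mono[OF ge1(1), of "u powr p"] mult_right_mono[OF ge1(2), of "v powr p"] by auto
  next
    case False
    then have pos: "0 < u" "0 < v" using uv by auto
    have w: "1 - b / ?s = a / ?s"
      using ab by (simp add: field_simps)
    have "(u + v) powr p = ((1 - b / ?s) *\<^sub>R (?s / a * u) + (b / ?s) *\<^sub>R (?s / b * v)) powr p"
      using ab by (simp add: w)
    also have "\<dots> \<le> (1 - b / ?s) * (?s / a * u) powr p + b / ?s * (?s / b * v) powr p"
      using ab pos by (intro convex_onD[OF powr_convex[OF p]]) auto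
    also note w
    also have "a / ?s * (?s / a * u) powr p + b / ?s * (?s / b * v) powr p
        = (?s / a) powr (p - 1) * u powr p + (?s / b) powr (p - 1) * v powr p"
    proof -
      have e: "(?s / a * u) powr p = (?s / a) powr p * u powr p"
              "(?s / b * v) powr p = (?s / b) powr p * v powr p"
        by (simp_all only: powr_mult)
      show ?thesis unfolding e using ab by (simp add: powr_diff mult_ac)
    qed
    finally show ?thesis .
  qed
  then show ?thesis
    using uv by (simp flip: ennreal_mult ennreal_plus)
qed

lemma Lp_enorm_lborel: "Lp_enorm p F = ennreal_powr (\<integral>\<^sup>+ x. ennreal_powr (F x) p \<partial>lborel) (1 / p)"
  by (simp add: Lp_enorm_def nn_integral_completion)

lemma Lp_enorm_powr:
  assumes "p \<noteq> 0"
  shows "ennreal_powr (Lp_enorm p F) p = (\<integral>\<^sup>+ x. ennreal_powr (F x) p \<partial>lborel)"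
  using assms by (simp add: Lp_enorm_lborel ennreal_powr_powr)

lemma Lp_enorm_mono_AE:
  assumes "0 < p" "AE x in lborel. F x \<le> G x"
  shows "Lp_enorm p F \<le> Lp_enorm p G"
  unfolding Lp_enorm_lborel using assms
  by (auto intro!: ennreal_powr_mono nn_integral_mono_AE)

lemma Lp_enorm_leI:
  assumes "0 < p" "0 \<le> c" "(\<integral>\<^sup>+ x. ennreal_powr (F x) p \<partial>lborel) \<le> ennreal (c powr p)"
  shows "Lp_enorm p F \<le> ennreal c"
  using ennreal_powr_mono[OF _ assms(3), of "1 / p"] assms(1,2)
  by (simp add: Lp_enorm_lborel powr_powr)

lemma Minkowski_Lp_enorm:
  assumes p: "1 \<le> p" and [measurable]: "F \<in> borel_measurable borel" "G \<in> borel_measurable borel"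
  shows "Lp_enorm p (\<lambda>x. F x + G x) \<le> Lp_enorm p F + Lp_enorm p G"
proof (cases "Lp_enorm p F = top \<or> Lp_enorm p G = top")
  case True
  then show ?thesis by auto
next
  case False
  then obtain a b where ab: "Lp_enorm p F = ennreal a" "0 \<le> a" "Lp_enorm p G = ennreal b" "0 \<le> b"
    by (cases "Lp_enorm p F"; cases "Lp_enorm p G") auto
  show ?thesis
  proof (rule ennreal_le_epsilon)
    fix e :: real assume e: "0 < e"
    \<comment> \<open>Enlarging both norms a little makes them positive, so that they can serve as weights.\<close>
    define a' b' where "a' = a + e / 2" and "b' = b + e / 2"
    have pos: "0 < a'" "0 < b'" "a \<le> a'" "b \<le> b'" using ab e by (auto simp: a'_def b'_def)
    let ?s = "a' + b'"
    have F: "(\<integral>\<^sup>+ x. ennreal_powr (F x) p \<partial>lborel) \<le> ennreal (a' powr p)"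
      using Lp_enorm_powr[of p F] ab pos p by (simp add: powr_mono2 flip: Lp_enorm_powr)
    have G: "(\<integral>\<^sup>+ x. ennreal_powr (G x) p \<partial>lborel) \<le> ennreal (b' powr p)"
      using Lp_enorm_powr[of p G] ab pos p by (simp add: powr_mono2 flip: Lp_enorm_powr)
    have "(\<integral>\<^sup>+ x. ennreal_powr (F x + G x) p \<partial>lborel)
        \<le> (\<integral>\<^sup>+ x. ennreal ((?s / a') powr (p - 1)) * ennreal_powr (F x) p
             + ennreal ((?s / b') powr (p - 1)) * ennreal_powr (G x) p \<partial>lborel)"
      using p pos by (intro nn_integral_mono ennreal_powr_add_convex)
    also have "\<dots> = ennreal ((?s / a') powr (p - 1)) * (\<integral>\<^sup>+ x. ennreal_powr (F x) p \<partial>lborel)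
             + ennreal ((?s / b') powr (p - 1)) * (\<integral>\<^sup>+ x. ennreal_powr (G x) p \<partial>lborel)"
      by (simp add: nn_integral_add nn_integral_cmult)
    also have "\<dots> \<le> ennreal ((?s / a') powr (p - 1)) * ennreal (a' powr p)
             + ennreal ((?s / b') powr (p - 1)) * ennreal (b' powr p)"
      by (intro add_mono mult_left_mono F G) auto
    also have "\<dots> = ennreal (?s powr (p - 1) * a' + ?s powr (p - 1) * b')"
      using pos by (simp add: powr_divide powr_diff flip: ennreal_mult ennreal_plus)
    also have "?s powr (p - 1) * a' + ?s powr (p - 1) * b' = ?s powr p"
      using powr_mult_base[of ?s "p - 1"] pos by (simp add: algebra_simps)
    finally have "Lp_enorm p (\<lambda>x. F x + G x) \<le> ennreal ?s"
      using p pos by (intro Lp_enorm_leI) auto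
    also have "?s = a + b + e" by (simp add: a'_def b'_def)
    finally show "Lp_enorm p (\<lambda>x. F x + G x) \<le> Lp_enorm p F + Lp_enorm p G + ennreal e"
      using ab e by (simp add: ennreal_plus)
  qed
qed

lemma Lp_enorm_sum_le:
  assumes p: "1 \<le> p" and [measurable]: "\<And>i. i \<in> I \<Longrightarrow> F i \<in> borel_measurable borel"
  shows "Lp_enorm p (\<lambda>x. \<Sum>i\<in>I. F i x) \<le> (\<Sum>i\<in>I. Lp_enorm p (F i))"
  using assms(2)
proof (induction I rule: infinite_finite_induct)
  case (insert i I)
  have "Lp_enorm p (\<lambda>x. F i x + (\<Sum>i\<in>I. F i x)) \<le> Lp_enorm p (F i) + Lp_enorm p (\<lambda>x. \<Sum>i\<in>I. F i x)"
    using insert by (intro Minkowski_Lp_enorm p borel_measurable_sum) auto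
  also have "\<dots> \<le> Lp_enorm p (F i) + (\<Sum>i\<in>I. Lp_enorm p (F i))"
    using insert by (intro add_mono) auto
  finally show ?case using insert by simp
qed (auto simp: Lp_enorm_lborel)

section \<open>Integrals of powers and level sets\<close>

lemma nn_integral_powr_below:
  assumes s: "0 < s"
  shows "(\<integral>\<^sup>+ l. ennreal (s * l powr (s - 1)) * indicator {l. 0 < l \<and> ennreal l < y} l \<partial>lborel)
       = ennreal_powr y s" (is "?I y = _")
proof -
  have fin: "?I (ennreal c) = ennreal (c powr s)" if c: "0 \<le> c" for c
  proof -
    have "((\<lambda>l. s * l powr (s - 1)) has_integral s * (c powr (s - 1 + 1) / (s - 1 + 1))) {0..c}"
      using s c by (intro has_integral_mult_right has_integral_powr_from_0) auto
    then have "(\<integral>\<^sup>+ l. ennreal (s * l powr (s - 1)) * indicator {0..c} l \<partial>lborel) = ennreal (c powr s)"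
      using s by (subst nn_integral_has_integral_lebesgue') auto
    moreover have "?I (ennreal c) = (\<integral>\<^sup>+ l. ennreal (s * l powr (s - 1)) * indicator {0..c} l \<partial>lborel)"
      using AE_lborel_singleton[of c]
      by (intro nn_integral_cong_AE, eventually_elim)
         (use c in \<open>auto simp: indicator_def ennreal_less_iff\<close>)
    ultimately show ?thesis by simp
  qed
  show ?thesis
  proof (cases y)
    case (real c)
    then show ?thesis using fin by simp
  next
    case top
    \<comment> \<open>If the integral up to \<open>\<infinity>\<close> were \<open>r\<close>, the integral up to the \<open>s\<close>-th root of \<open>r + 1\<close> would exceed it.\<close>
    have "?I top = top"
    proof (rule ccontr)
      assume "?I top \<noteq> top"
      then obtain r where r: "?I top = ennreal r" "0 \<le> r" by (cases "?I top") auto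
      have "?I (ennreal ((r + 1) powr (1 / s))) \<le> ?I top"
        by (intro nn_integral_mono mult_left_mono) (auto simp: indicator_def)
      then have "ennreal (r + 1) \<le> ennreal r"
        using s r fin[of "(r + 1) powr (1 / s)"] by (simp add: powr_powr)
      then show False using r by simp
    qed
    then show ?thesis using top by simp
  qed
qed

text \<open>Tonelli's theorem applied to \<open>F\<^sup>s = \<integral>\<^bsub>0 < l < F\<^esub> s l\<^sup>s\<^sup>-\<^sup>1\<close>. The weight \<open>W\<close> allows two uses: with \<open>W = 1\<close> and
\<open>s = p\<close> it expresses the \<open>p\<close>-th power of a norm by the sizes of level sets, and with \<open>W = F\<close> and
\<open>s = p - 1\<close> it recovers that power from the integrals of \<open>F\<close> over its level sets. The quotient
\<open>p / (p - 1)\<close> of the two normalizing factors is the one in the theorem.\<close>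
lemma layer_cake:
  fixes F W :: "real \<Rightarrow> ennreal"
  assumes s: "0 < s" and [measurable]: "F \<in> borel_measurable borel" "W \<in> borel_measurable borel"
  shows "(\<integral>\<^sup>+ l. ennreal (s * l powr (s - 1)) * indicator {0<..} l *
            (\<integral>\<^sup>+ x. W x * indicator {x. ennreal l < F x} x \<partial>lborel) \<partial>lborel)
       = (\<integral>\<^sup>+ x. W x * ennreal_powr (F x) s \<partial>lborel)"
proof -
  let ?k = "\<lambda>l::real. \<lambda>x::real. (if 0 < l \<and> ennreal l < F x then ennreal (s * l powr (s - 1)) * W x else 0)"
  have "(\<integral>\<^sup>+ l. ennreal (s * l powr (s - 1)) * indicator {0<..} l *
            (\<integral>\<^sup>+ x. W x * indicator {x. ennreal l < F x} x \<partial>lborel) \<partial>lborel)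
      = (\<integral>\<^sup>+ l. (\<integral>\<^sup>+ x. ?k l x \<partial>lborel) \<partial>lborel)"
    by (subst nn_integral_cmult[symmetric])
       (auto intro!: nn_integral_cong simp: indicator_def)
  also have "\<dots> = (\<integral>\<^sup>+ x. (\<integral>\<^sup>+ l. ?k l x \<partial>lborel) \<partial>lborel)"
    by (rule lborel_pair.Fubini'[symmetric]) measurable
  also have "\<dots> = (\<integral>\<^sup>+ x. W x * (\<integral>\<^sup>+ l. ennreal (s * l powr (s - 1)) * indicator {l. 0 < l \<and> ennreal l < F x} l \<partial>lborel) \<partial>lborel)"
    by (subst nn_integral_cmult[symmetric])
       (auto intro!: nn_integral_cong simp: indicator_def mult.commute)
  also have "\<dots> = (\<integral>\<^sup>+ x. W x * ennreal_powr (F x) s \<partial>lborel)"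
    using s by (simp add: nn_integral_powr_below)
  finally show ?thesis .
qed

text \<open>The layer cake formula arranged with the density of exponent \<open>p - 1\<close>, so that an inequality between
\<open>l * |{F > l}|\<close> and an integral of another function over a level set can be inserted directly.\<close>
lemma nn_integral_powr_level_sets:
  fixes F :: "real \<Rightarrow> ennreal"
  assumes p: "1 < p" and [measurable]: "F \<in> borel_measurable borel"
  shows "(\<integral>\<^sup>+ x. ennreal_powr (F x) p \<partial>lborel)
       = (\<integral>\<^sup>+ l. ennreal (p / (p - 1)) * (ennreal ((p - 1) * l powr (p - 1 - 1)) * indicator {0<..} l *
            (ennreal l * emeasure lborel {x. ennreal l < F x})) \<partial>lborel)"
proof -
  have "(\<integral>\<^sup>+ x. ennreal_powr (F x) p \<partial>lborel) = (\<integral>\<^sup>+ x. 1 * ennreal_powr (F x) p \<partial>lborel)"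
    by simp
  also have "\<dots> = (\<integral>\<^sup>+ l. ennreal (p * l powr (p - 1)) * indicator {0<..} l *
            (\<integral>\<^sup>+ x. 1 * indicator {x. ennreal l < F x} x \<partial>lborel) \<partial>lborel)"
    using p by (intro layer_cake[where W = "\<lambda>_. 1", symmetric]) auto
  also have "\<dots> = (\<integral>\<^sup>+ l. ennreal (p / (p - 1)) * (ennreal ((p - 1) * l powr (p - 1 - 1)) * indicator {0<..} l *
            (ennreal l * emeasure lborel {x. ennreal l < F x})) \<partial>lborel)"
  proof (rule nn_integral_cong)
    fix l :: real
    have "ennreal (p * l powr (p - 1)) = ennreal (p / (p - 1)) * (ennreal ((p - 1) * l powr (p - 1 - 1)) * ennreal l)"
      if "0 < l"
    proof -
      have "l * l powr (p - 1 - 1) = l powr (p - 1)"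
        using that by (subst powr_mult_base) auto
      then show ?thesis using p that by (simp add: mult_ac flip: ennreal_mult)
    qed
    then show "ennreal (p * l powr (p - 1)) * indicator {0<..} l *
            (\<integral>\<^sup>+ x. 1 * indicator {x. ennreal l < F x} x \<partial>lborel)
        = ennreal (p / (p - 1)) * (ennreal ((p - 1) * l powr (p - 1 - 1)) * indicator {0<..} l *
            (ennreal l * emeasure lborel {x. ennreal l < F x}))"
      by (cases "0 < l") (simp_all add: mult_ac)
  qed
  finally show ?thesis .
qed

section \<open>The centered maximal operator on functions with values in \<open>[0, \<infinity>]\<close>\<close>

text \<open>The integral over a window is the supremum of the integrals over slightly shorter windows, and
these remain inside the window when its position changes a little. This lower semicontinuity is
the source of all measurability below.\<close>
lemma open_window_integral_greater:
  fixes F :: "real \<Rightarrow> ennreal"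
  assumes [measurable]: "F \<in> borel_measurable borel"
  shows "open {x. c < (\<integral>\<^sup>+ y\<in>{x - a..x + b}. F y \<partial>lborel)}"
proof (rule openI)
  fix x assume x: "x \<in> {x. c < (\<integral>\<^sup>+ y\<in>{x - a..x + b}. F y \<partial>lborel)}"
  let ?S = "\<lambda>n. {x - a + 1 / Suc n..x + b - 1 / Suc n}"
  have inc: "incseq (\<lambda>n y. F y * indicator (?S n) y)"
  proof (intro incseq_SucI le_funI mult_left_mono)
    fix n y
    have "1 / real (Suc (Suc n)) \<le> 1 / real (Suc n)" by (simp add: divide_simps)
    then have "?S n \<subseteq> ?S (Suc n)" by (intro atLeastatMost_subset_iff[THEN iffD2]) auto
    then show "indicator (?S n) y \<le> (indicator (?S (Suc n)) y :: ennreal)"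
      by (auto split: split_indicator)
  qed auto
  have SUP: "(SUP n. F y * indicator (?S n) y) = F y * indicator {x - a<..<x + b} y" for y
  proof (cases "y \<in> {x - a<..<x + b}")
    case True
    define d where "d = min (y - (x - a)) (x + b - y)"
    have "0 < d" using True by (simp add: d_def)
    then obtain n where "inverse (real (Suc n)) < d" using reals_Archimedean by blast
    then have "y \<in> ?S n" by (auto simp: d_def inverse_eq_divide)
    then have "F y \<le> (SUP n. F y * indicator (?S n) y)"
      by (intro SUP_upper2[of n]) auto
    moreover have "(SUP n. F y * indicator (?S n) y) \<le> F y"
      by (intro SUP_least) (auto simp: indicator_def)
    ultimately show ?thesis using True by auto
  next
    case False
    have "0 < 1 / real (Suc n)" for n by simp
    then have "y \<notin> ?S n" for n
      using False by (smt (verit) atLeastAtMost_iff greaterThanLessThan_iff)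
    then have z: "indicator (?S n) y = (0 :: ennreal)" for n
      unfolding indicator_def by simp
    show ?thesis using False unfolding z by simp
  qed
  have "(\<integral>\<^sup>+ y\<in>{x - a..x + b}. F y \<partial>lborel) = (\<integral>\<^sup>+ y. F y * indicator {x - a<..<x + b} y \<partial>lborel)"
    using AE_lborel_singleton[of "x - a"] AE_lborel_singleton[of "x + b"]
    by (intro nn_integral_cong_AE, eventually_elim) (auto simp: indicator_def)
  also have "\<dots> = (SUP n. \<integral>\<^sup>+ y. F y * indicator (?S n) y \<partial>lborel)"
    unfolding SUP[symmetric] by (rule nn_integral_monotone_convergence_SUP[OF inc]) measurable
  finally obtain n where n: "c < (\<integral>\<^sup>+ y\<in>?S n. F y \<partial>lborel)"
    using x by (auto simp: less_SUP_iff)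
  show "\<exists>e>0. ball x e \<subseteq> {x. c < (\<integral>\<^sup>+ y\<in>{x - a..x + b}. F y \<partial>lborel)}"
  proof (intro exI[of _ "1 / Suc n"] conjI subsetI)
    fix x' assume x': "x' \<in> ball x (1 / Suc n)"
    then have "?S n \<subseteq> {x' - a..x' + b}" by (auto simp: dist_real_def)
    then have "(\<integral>\<^sup>+ y\<in>?S n. F y \<partial>lborel) \<le> (\<integral>\<^sup>+ y\<in>{x' - a..x' + b}. F y \<partial>lborel)"
      by (intro nn_integral_mono mult_left_mono) (auto split: split_indicator)
    with n show "x' \<in> {x. c < (\<integral>\<^sup>+ y\<in>{x - a..x + b}. F y \<partial>lborel)}" by auto
  qed auto
qed

text \<open>The centered maximal operator for functions with values in \<open>[0, \<infinity>]\<close>, which makes it possible to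
iterate it: maximal functions may be infinite at some points.\<close>
definition hl_max :: "(real \<Rightarrow> ennreal) \<Rightarrow> real \<Rightarrow> ennreal" where
  "hl_max F x = (SUP r\<in>{0<..}. (\<integral>\<^sup>+ y\<in>{x - r..x + r}. F y \<partial>lborel) / ennreal (2 * r))"

lemma centered_maximal_eq_hl_max: "centered_maximal f = hl_max (\<lambda>x. ennreal \<bar>f x\<bar>)"
  by (simp add: fun_eq_iff centered_maximal_def hl_max_def nn_integral_completion)

lemma hl_max_upper:
  "0 < r \<Longrightarrow> (\<integral>\<^sup>+ y\<in>{x - r..x + r}. F y \<partial>lborel) / ennreal (2 * r) \<le> hl_max F x"
  unfolding hl_max_def by (rule SUP_upper) simp

lemma ennreal_less_divide_iff:
  assumes "0 < r"
  shows "c < X / ennreal r \<longleftrightarrow> ennreal r * c < X"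
  using assms
  by (cases X; cases c)
     (auto simp: divide_ennreal ennreal_mult_top ennreal_top_divide ennreal_less_iff field_simps
           simp flip: ennreal_mult)

lemma open_hl_max_greater:
  assumes "F \<in> borel_measurable borel"
  shows "open {x. c < hl_max F x}"
proof -
  have "{x. c < hl_max F x} = (\<Union>r\<in>{0<..}. {x. ennreal (2 * r) * c < (\<integral>\<^sup>+ y\<in>{x - r..x + r}. F y \<partial>lborel)})"
    by (auto simp: hl_max_def less_SUP_iff ennreal_less_divide_iff)
  then show ?thesis
    by (auto intro!: open_window_integral_greater assms)
qed

lemma borel_measurable_hl_max [measurable (raw)]:
  "F \<in> borel_measurable borel \<Longrightarrow> hl_max F \<in> borel_measurable borel"
  by (rule borel_measurableI_greater) (simp add: borel_open open_hl_max_greater)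

lemma hl_max_mono_AE:
  assumes "AE x in lborel. F x \<le> G x"
  shows "hl_max F x \<le> hl_max G x"
  unfolding hl_max_def
proof (intro SUP_mono' divide_right_mono_ennreal nn_integral_mono_AE)
  fix r
  show "AE y in lborel. F y * indicator {x - r..x + r} y \<le> G y * indicator {x - r..x + r} y"
    using assms by eventually_elim (auto intro: mult_right_mono)
qed

lemma hl_max_cong_AE: "AE x in lborel. F x = G x \<Longrightarrow> hl_max F = hl_max G"
  by (intro ext antisym hl_max_mono_AE) (auto elim!: eventually_mono)

lemma hl_max_add:
  assumes [measurable]: "F \<in> borel_measurable borel" "G \<in> borel_measurable borel"
  shows "hl_max (\<lambda>x. F x + G x) x \<le> hl_max F x + hl_max G x"
  unfolding hl_max_def[of "\<lambda>x. F x + G x"]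
proof (rule SUP_least)
  fix r :: real assume "r \<in> {0<..}"
  then have "0 < r" by simp
  have "(\<integral>\<^sup>+ y\<in>{x - r..x + r}. F y + G y \<partial>lborel) / ennreal (2 * r)
      = (\<integral>\<^sup>+ y\<in>{x - r..x + r}. F y \<partial>lborel) / ennreal (2 * r) + (\<integral>\<^sup>+ y\<in>{x - r..x + r}. G y \<partial>lborel) / ennreal (2 * r)"
    by (simp add: distrib_right nn_integral_add add_divide_distrib_ennreal)
  also have "\<dots> \<le> hl_max F x + hl_max G x"
    using \<open>0 < r\<close> by (intro add_mono hl_max_upper)
  finally show "(\<integral>\<^sup>+ y\<in>{x - r..x + r}. F y + G y \<partial>lborel) / ennreal (2 * r) \<le> hl_max F x + hl_max G x" .
qed

lemma hl_max_const_le: "hl_max (\<lambda>x. c) x \<le> c"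
  unfolding hl_max_def
proof (rule SUP_least)
  fix r :: real assume "r \<in> {0<..}"
  then show "(\<integral>\<^sup>+ y\<in>{x - r..x + r}. c \<partial>lborel) / ennreal (2 * r) \<le> c"
    by (simp add: nn_integral_cmult_indicator ennreal_mult_divide_eq)
qed

lemma hl_max_sum:
  assumes "\<And>i. i \<in> I \<Longrightarrow> F i \<in> borel_measurable borel"
  shows "hl_max (\<lambda>x. \<Sum>i\<in>I. F i x) x \<le> (\<Sum>i\<in>I. hl_max (F i) x)"
  using assms
proof (induction I rule: infinite_finite_induct)
  case (insert i I)
  have "hl_max (\<lambda>x. F i x + (\<Sum>i\<in>I. F i x)) x \<le> hl_max (F i) x + hl_max (\<lambda>x. \<Sum>i\<in>I. F i x) x"
    using insert by (intro hl_max_add borel_measurable_sum) auto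
  also have "\<dots> \<le> hl_max (F i) x + (\<Sum>i\<in>I. hl_max (F i) x)"
    using insert by (intro add_mono) auto
  finally show ?case using insert by simp
qed (use hl_max_const_le[of 0 x] in auto)

definition hl_iter :: "nat \<Rightarrow> (real \<Rightarrow> ennreal) \<Rightarrow> real \<Rightarrow> ennreal" where
  "hl_iter n F = (hl_max ^^ n) F"

lemma hl_iter_0 [simp]: "hl_iter 0 F = F"
  and hl_iter_Suc: "hl_iter (Suc n) F = hl_max (hl_iter n F)"
  by (simp_all add: hl_iter_def)

lemma borel_measurable_hl_iter [measurable (raw)]:
  "F \<in> borel_measurable borel \<Longrightarrow> hl_iter n F \<in> borel_measurable borel"
  by (induction n) (auto simp: hl_iter_Suc intro: borel_measurable_hl_max)

section \<open>Differentiation of integrals\<close>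

lemma nn_integral_interval_combine:
  fixes F :: "real \<Rightarrow> ennreal"
  assumes [measurable]: "F \<in> borel_measurable borel" and "a \<le> b" "b \<le> c"
  shows "(\<integral>\<^sup>+ y\<in>{a..c}. F y \<partial>lborel) = (\<integral>\<^sup>+ y\<in>{a..b}. F y \<partial>lborel) + (\<integral>\<^sup>+ y\<in>{b..c}. F y \<partial>lborel)"
proof -
  have "(\<integral>\<^sup>+ y\<in>{a..c}. F y \<partial>lborel)
      = (\<integral>\<^sup>+ y. F y * indicator {a..b} y + F y * indicator {b..c} y \<partial>lborel)"
    using AE_lborel_singleton[of b]
    by (intro nn_integral_cong_AE, eventually_elim) (use assms in \<open>auto simp: indicator_def\<close>)
  then show ?thesis by (simp add: nn_integral_add)
qed

lemma locally_integrable_nn_integral: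
  fixes f :: "real \<Rightarrow> real"
  assumes [measurable]: "f \<in> borel_measurable borel" and nn: "\<And>x. 0 \<le> f x"
    and fin: "(\<integral>\<^sup>+ y\<in>{a..b}. ennreal (f y) \<partial>lborel) < \<infinity>"
  shows "f integrable_on {a..b}"
    and "(\<integral>\<^sup>+ y\<in>{a..b}. ennreal (f y) \<partial>lborel) = ennreal (integral {a..b} f)"
proof -
  have "set_integrable lborel {a..b} f"
    unfolding set_integrable_def
  proof (rule integrableI_bounded)
    have "(\<integral>\<^sup>+ x. ennreal (norm (indicator {a..b} x *\<^sub>R f x)) \<partial>lborel) = (\<integral>\<^sup>+ y\<in>{a..b}. ennreal (f y) \<partial>lborel)"
      using nn by (intro nn_integral_cong) (auto simp: indicator_def)
    then show "(\<integral>\<^sup>+ x. ennreal (norm (indicator {a..b} x *\<^sub>R f x)) \<partial>lborel) < \<infinity>"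
      using fin by simp
  qed simp
  then show "f integrable_on {a..b}" by (rule set_borel_integral_eq_integral)
  show "(\<integral>\<^sup>+ y\<in>{a..b}. ennreal (f y) \<partial>lborel) = ennreal (integral {a..b} f)"
    using nn fin by (intro set_nn_integral_lborel_eq_integral) (auto simp: set_borel_measurable_def)
qed

text \<open>Lebesgue's differentiation theorem for right-hand intervals: almost everywhere the averages over
\<open>[x, x + h]\<close> tend to \<open>f x\<close>.\<close>
lemma AE_right_average:
  fixes f :: "real \<Rightarrow> real"
  assumes [measurable]: "f \<in> borel_measurable borel" and nn: "\<And>x. 0 \<le> f x"
    and fin: "\<And>a b. (\<integral>\<^sup>+ y\<in>{a..b}. ennreal (f y) \<partial>lborel) < \<infinity>"
  shows "AE x in lborel. \<forall>\<nu><f x. \<exists>d>0. \<forall>h. 0 < h \<and> h < d \<longrightarrow>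
           ennreal (\<nu> * h) \<le> (\<integral>\<^sup>+ y\<in>{x..x + h}. ennreal (f y) \<partial>lborel)"
proof -
  note loc = locally_integrable_nn_integral[OF assms(1) nn fin]
  obtain N where N: "negligible N" and lim: "\<And>x e. \<lbrakk>x \<notin> N; 0 < e\<rbrakk> \<Longrightarrow>
      \<exists>d>0. \<forall>h. 0 < h \<and> h < d \<longrightarrow> norm (integral (cbox x (x + h *\<^sub>R One)) f /\<^sub>R h ^ DIM(real) - f x) < e"
    using integrable_ccontinuous_explicit[of f] loc(1) by (metis interval_cbox)
  have "AE x in lebesgue. x \<notin> N"
    using N by (simp add: negligible_iff_null_sets AE_not_in)
  then have "AE x in lborel. x \<notin> N"
    by (simp only: AE_completion_iff)
  then show ?thesis
  proof eventually_elim
    case (elim x)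
    show ?case
    proof (intro allI impI)
      fix \<nu> assume "\<nu> < f x"
      then obtain d where d: "0 < d"
        "\<And>h. 0 < h \<and> h < d \<Longrightarrow> \<bar>integral {x..x + h} f / h - f x\<bar> < f x - \<nu>"
        using lim[OF elim, of "f x - \<nu>"] by (auto simp: divide_inverse mult.commute)
      have "ennreal (\<nu> * h) \<le> (\<integral>\<^sup>+ y\<in>{x..x + h}. ennreal (f y) \<partial>lborel)" if h: "0 < h \<and> h < d" for h
      proof -
        have "\<nu> < integral {x..x + h} f / h" using d(2)[OF h] by (simp add: abs_less_iff)
        then show ?thesis using h by (auto simp: loc(2) less_divide_eq intro!: ennreal_leI)
      qed
      with \<open>0 < d\<close> show "\<exists>d>0. \<forall>h. 0 < h \<and> h < d \<longrightarrow>
           ennreal (\<nu> * h) \<le> (\<integral>\<^sup>+ y\<in>{x..x + h}. ennreal (f y) \<partial>lborel)" by blast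
    qed
  qed
qed

text \<open>Right-hand averages of \<open>f\<close> and of its reflection converge almost everywhere; together they control
the averages over symmetric intervals.\<close>
lemma AE_le_hl_max:
  fixes f :: "real \<Rightarrow> real"
  assumes f[measurable]: "f \<in> borel_measurable borel" and nn: "\<And>x. 0 \<le> f x"
    and fin: "\<And>a b. (\<integral>\<^sup>+ y\<in>{a..b}. ennreal (f y) \<partial>lborel) < \<infinity>"
  shows "AE x in lborel. ennreal (f x) \<le> hl_max (\<lambda>x. ennreal (f x)) x"
proof -
  have refl: "(\<integral>\<^sup>+ y\<in>{a..b}. ennreal (f (- y)) \<partial>lborel) = (\<integral>\<^sup>+ y\<in>{- b..- a}. ennreal (f y) \<partial>lborel)" for a b
    by (subst nn_integral_real_affine[where c = "-1" and t = 0])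
       (auto intro!: nn_integral_cong simp: indicator_def)
  let ?P = "\<lambda>x. \<forall>\<nu><f (- x). \<exists>d>0. \<forall>h. 0 < h \<and> h < d \<longrightarrow>
           ennreal (\<nu> * h) \<le> (\<integral>\<^sup>+ y\<in>{x..x + h}. ennreal (f (- y)) \<partial>lborel)"
  have "AE x in lborel. ?P x"
    by (rule AE_right_average) (use fin nn in \<open>auto simp: refl\<close>)
  then have "AE x in distr lborel borel uminus. ?P x"
    by (subst lborel_distr_uminus)
  then have left: "AE x in lborel. ?P (- x)"
    by (rule AE_distrD[rotated]) simp
  from left AE_right_average[OF assms] show ?thesis
  proof eventually_elim
    case (elim x)
    show ?case
    proof (rule ennreal_le_epsilon)
      fix e :: real assume e: "0 < e"
      have "f x - e < f (- (- x))" using e by simp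
      with elim(1) obtain d where d: "0 < d" "\<And>h. 0 < h \<and> h < d \<Longrightarrow>
           ennreal ((f x - e) * h) \<le> (\<integral>\<^sup>+ y\<in>{- x..- x + h}. ennreal (f (- y)) \<partial>lborel)"
        by blast
      have "f x - e < f x" using e by simp
      with elim(2) obtain d' where d': "0 < d'" "\<And>h. 0 < h \<and> h < d' \<Longrightarrow>
           ennreal ((f x - e) * h) \<le> (\<integral>\<^sup>+ y\<in>{x..x + h}. ennreal (f y) \<partial>lborel)"
        by blast
      define h where "h = min d d' / 2"
      have h: "0 < h" "h < d" "h < d'" using d d' by (auto simp: h_def)
      have "ennreal (f x - e) \<le> hl_max (\<lambda>x. ennreal (f x)) x"
      proof (cases "0 \<le> f x - e")
        case True
        have "ennreal (f x - e) = ennreal ((f x - e) * h + (f x - e) * h) / ennreal (2 * h)"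
          using True h by (subst divide_ennreal) (auto simp: field_simps)
        also have "\<dots> = (ennreal ((f x - e) * h) + ennreal ((f x - e) * h)) / ennreal (2 * h)"
          using True h by (subst ennreal_plus) auto
        also have "\<dots> \<le> ((\<integral>\<^sup>+ y\<in>{x - h..x}. ennreal (f y) \<partial>lborel) + (\<integral>\<^sup>+ y\<in>{x..x + h}. ennreal (f y) \<partial>lborel)) / ennreal (2 * h)"
          using d(2)[of h] d'(2)[of h] h by (intro divide_right_mono_ennreal add_mono) (auto simp: refl)
        also have "\<dots> = (\<integral>\<^sup>+ y\<in>{x - h..x + h}. ennreal (f y) \<partial>lborel) / ennreal (2 * h)"
          using h by (subst nn_integral_interval_combine[of _ "x - h" x "x + h"]) auto
        also have "\<dots> \<le> hl_max (\<lambda>x. ennreal (f x)) x"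
          by (rule hl_max_upper[OF h(1)])
        finally show ?thesis .
      qed (simp add: ennreal_neg)
      then have "ennreal (f x - e) + ennreal e \<le> hl_max (\<lambda>x. ennreal (f x)) x + ennreal e"
        by (rule add_right_mono)
      moreover have "ennreal (f x) \<le> ennreal (f x - e) + ennreal e"
        using e by (cases "0 \<le> f x - e") (auto simp: ennreal_neg intro: ennreal_leI simp flip: ennreal_plus)
      ultimately show "ennreal (f x) \<le> hl_max (\<lambda>x. ennreal (f x)) x + ennreal e" by order
    qed
  qed
qed

section \<open>A lower bound for the iterated maximal function\<close>

lemma AE_le_hl_iter:
  assumes "AE x in lborel. F x \<le> hl_max F x"
  shows "AE x in lborel. F x \<le> hl_iter n F x"
proof (induction n)
  case (Suc n)
  then have "hl_max F x \<le> hl_iter (Suc n) F x" for x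
    unfolding hl_iter_Suc by (rule hl_max_mono_AE)
  with assms show ?case by (auto elim!: eventually_mono intro: order_trans)
qed simp

text \<open>The recursion of \<open>g_seq\<close> is what the maximal operator does to an interval \<open>J = [x, x + h]\<close> with mean
at least \<open>\<nu>\<close>, seen from distance \<open>t h\<close> to its left. The symmetric interval about \<open>x - t h\<close> that ends
at the far end of \<open>J\<close> has length \<open>2 h (1 + t)\<close> and consists of \<open>J\<close>, which contributes \<open>\<nu> h\<close> because the
iterates dominate \<open>F\<close>, and of the points at distance up to \<open>(1 + 2 t) h\<close> from \<open>J\<close>, where the
induction hypothesis applies. At \<open>t = 0\<close> the bound is \<open>\<nu> \<gamma>\<^sub>n\<close>.\<close>
lemma hl_iter_ge_g_seq:
  assumes [measurable]: "F \<in> borel_measurable borel" and le: "AE x in lborel. F x \<le> hl_max F x"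
    and h: "0 < h" and \<nu>: "0 \<le> \<nu>"
    and avg: "ennreal (\<nu> * h) \<le> (\<integral>\<^sup>+ y\<in>{x..x + h}. F y \<partial>lborel)"
    and "0 \<le> t"
  shows "ennreal (\<nu> * g_seq n t) \<le> hl_iter n F (x - t * h)"
  using \<open>0 \<le> t\<close>
proof (induction n arbitrary: t)
  case 0
  then show ?case by simp
next
  case (Suc n)
  let ?z = "x - t * h" and ?r = "h * (1 + t)" and ?G = "hl_iter n F"
  let ?I = "integral {0..1 + 2 * t} (g_seq n)"
  have r: "0 < ?r" using h Suc.prems by simp
  have I: "0 \<le> ?I"
    using g_seq_continuous_nonneg[of n] by (intro integral_nonneg g_seq_integrable) auto
  have "ennreal (\<nu> * h * ?I) = ennreal h * ennreal (\<nu> * ?I)"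
    using h \<nu> I by (simp add: mult_ac flip: ennreal_mult)
  also have "ennreal (\<nu> * ?I) = (\<integral>\<^sup>+ u. ennreal (\<nu> * g_seq n u) * indicator {0..1 + 2 * t} u \<partial>lborel)"
    using \<nu> g_seq_continuous_nonneg[of n] g_seq_integrable[of 0 n "1 + 2 * t"]
    by (intro nn_integral_has_integral_lebesgue'[symmetric] has_integral_mult_right)
       (auto intro: integrable_integral)
  also have "\<dots> \<le> (\<integral>\<^sup>+ u. ?G (x - u * h) * indicator {0..1 + 2 * t} u \<partial>lborel)"
    using Suc.IH by (intro nn_integral_mono) (auto simp: indicator_def)
  also have "ennreal h * \<dots> = (\<integral>\<^sup>+ y\<in>{x - h * (1 + 2 * t)..x}. ?G y \<partial>lborel)"
  proof -
    have ind: "indicator {x - h * (1 + 2 * t)..x} (x + - h * u) = (indicator {0..1 + 2 * t} u :: ennreal)" for u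
      using h by (auto simp: indicator_def zero_le_mult_iff)
    have "(\<integral>\<^sup>+ y\<in>{x - h * (1 + 2 * t)..x}. ?G y \<partial>lborel)
        = ennreal \<bar>- h\<bar> * (\<integral>\<^sup>+ u. ?G (x + - h * u) * indicator {x - h * (1 + 2 * t)..x} (x + - h * u) \<partial>lborel)"
      using h by (intro nn_integral_real_affine) auto
    then show ?thesis using h unfolding ind by (simp add: mult.commute)
  qed
  finally have left: "ennreal (\<nu> * h * ?I) \<le> (\<integral>\<^sup>+ y\<in>{x - h * (1 + 2 * t)..x}. ?G y \<partial>lborel)"
    using h by (simp add: mult_left_mono)
  have right: "ennreal (\<nu> * h) \<le> (\<integral>\<^sup>+ y\<in>{x..x + h}. ?G y \<partial>lborel)"
    using AE_le_hl_iter[OF le, of n]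
    by (intro order_trans[OF avg] nn_integral_mono_AE) (auto elim!: eventually_mono intro: mult_right_mono)
  have "ennreal (\<nu> * g_seq (Suc n) t) = ennreal (\<nu> * h * ?I + \<nu> * h) / ennreal (2 * ?r)"
    using h \<nu> I r Suc.prems by (subst divide_ennreal) (auto simp: field_simps)
  also have "\<dots> = (ennreal (\<nu> * h * ?I) + ennreal (\<nu> * h)) / ennreal (2 * ?r)"
    using h \<nu> I by (subst ennreal_plus) auto
  also have "\<dots> \<le> ((\<integral>\<^sup>+ y\<in>{x - h * (1 + 2 * t)..x}. ?G y \<partial>lborel) + (\<integral>\<^sup>+ y\<in>{x..x + h}. ?G y \<partial>lborel)) / ennreal (2 * ?r)"
    by (intro divide_right_mono_ennreal add_mono left right)
  also have "\<dots> = (\<integral>\<^sup>+ y\<in>{x - h * (1 + 2 * t)..x + h}. ?G y \<partial>lborel) / ennreal (2 * ?r)"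
    using h Suc.prems by (subst nn_integral_interval_combine[of _ "x - h * (1 + 2 * t)" x "x + h"]) auto
  also have "x - h * (1 + 2 * t) = ?z - ?r" by (simp add: algebra_simps)
  also have "x + h = ?z + ?r" by (simp add: algebra_simps)
  also have "(\<integral>\<^sup>+ y\<in>{?z - ?r..?z + ?r}. ?G y \<partial>lborel) / ennreal (2 * ?r) \<le> hl_iter (Suc n) F ?z"
    unfolding hl_iter_Suc by (rule hl_max_upper[OF r])
  finally show ?case .
qed

lemma left_endpoint_component_notin:
  fixes E :: "real set"
  assumes "open E" and C: "C \<in> components E" "bdd_below C"
  shows "Inf C \<notin> E"
proof
  assume inE: "Inf C \<in> E"
  have ne: "C \<noteq> {}" and "open C"
    using assms by (auto simp: in_components_nonempty open_components)
  have "Inf C \<in> closure C"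
    using ne C(2) by (rule closure_contains_Inf)
  moreover have "closedin (top_of_set E) C"
    by (rule closedin_component[OF C(1)])
  ultimately have "Inf C \<in> C"
    using inE by (auto simp: closedin_limpt closure_def)
  then obtain e where "0 < e" "ball (Inf C) e \<subseteq> C"
    using \<open>open C\<close> by (meson open_contains_ball)
  then have "Inf C - e / 2 \<in> C" by (auto simp: dist_real_def subset_iff)
  then have "Inf C \<le> Inf C - e / 2" by (rule cInf_lower[OF _ C(2)])
  then show False using \<open>0 < e\<close> by simp
qed

lemma interval_bounded_of_finite_measure:
  fixes C :: "real set"
  assumes "is_interval C" "C \<noteq> {}" "emeasure lborel C < \<infinity>" "C \<in> sets borel"
  shows "bdd_below C" "bdd_above C"
proof -
  obtain x where x: "x \<in> C" using assms(2) by blast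
  have mem: "\<And>a b c. a \<in> C \<Longrightarrow> b \<in> C \<Longrightarrow> a \<le> c \<Longrightarrow> c \<le> b \<Longrightarrow> c \<in> C"
    using assms(1) unfolding is_interval_1 by blast
  have bound: "y - z \<le> measure lborel C" if "y \<in> C" "z \<in> C" "z \<le> y" for y z
  proof -
    have "{z..y} \<subseteq> C" using mem[OF that(2,1)] by auto
    then have "emeasure lborel {z..y} \<le> emeasure lborel C"
      using assms(4) by (intro emeasure_mono) auto
    then have "ennreal (y - z) \<le> ennreal (measure lborel C)"
      using assms(3) that(3) by (simp add: emeasure_eq_ennreal_measure)
    then show ?thesis by (simp add: ennreal_le_iff)
  qed
  show "bdd_below C"
    using bound[OF x] by (intro bdd_belowI[of _ "x - measure lborel C"]) (smt (verit) measure_nonneg)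
  show "bdd_above C"
    using bound[OF _ x] by (intro bdd_aboveI[of _ "x + measure lborel C"]) (smt (verit) measure_nonneg)
qed

text \<open>The half of Riesz's rising sun lemma that bounds the integral from above. \<open>E\<close> is the set where the
right-sided maximal function exceeds \<open>\<nu>\<close>. The left endpoint of a component of \<open>E\<close> lies outside
\<open>E\<close>, hence the mean of \<open>F\<close> over the component is at most \<open>\<nu>\<close>; the components are then added up.
Finiteness of the measure ensures that the left endpoints exist.\<close>
lemma rising_sun_inequality:
  fixes F :: "real \<Rightarrow> ennreal" and \<nu> :: real
  assumes [measurable]: "F \<in> borel_measurable borel"
  defines "E \<equiv> {x. \<exists>h>0. ennreal (\<nu> * h) < (\<integral>\<^sup>+ y\<in>{x..x + h}. F y \<partial>lborel)}"
  assumes fin: "emeasure lborel E < \<infinity>"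
  shows "open E" and "(\<integral>\<^sup>+ x\<in>E. F x \<partial>lborel) \<le> ennreal \<nu> * emeasure lborel E"
proof -
  have "E = (\<Union>h\<in>{0<..}. {x. ennreal (\<nu> * h) < (\<integral>\<^sup>+ y\<in>{x - 0..x + h}. F y \<partial>lborel)})"
    by (auto simp: E_def)
  also have "open \<dots>" by (intro open_UN ballI open_window_integral_greater) simp
  finally show "open E" .
  note comp_open = open_components[OF \<open>open E\<close>]
  have [measurable]: "C \<in> sets borel" if "C \<in> components E" for C
    using comp_open[OF that] by simp
  have disj: "disjoint_family_on (\<lambda>C. C) (components E)"
    using pairwise_disjoint_components[of E] by (auto simp: disjoint_family_on_def pairwise_def)
  have count: "countable (components E)"
    using pairwise_disjoint_components[of E] comp_open
    by (intro countable_disjoint_open_subsets) (auto simp: pairwise_def disjnt_def)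
  have E_UN: "E = (\<Union>C\<in>components E. C)" using Union_components[of E] by simp
  have comp: "(\<integral>\<^sup>+ x\<in>C. F x \<partial>lborel) \<le> ennreal \<nu> * emeasure lborel C" if C: "C \<in> components E" for C
  proof -
    have ne: "C \<noteq> {}" and conn: "connected C" and sub: "C \<subseteq> E"
      using C by (auto simp: in_components_nonempty in_components_connected in_components_subset)
    have "emeasure lborel C \<le> emeasure lborel E"
      using sub \<open>open E\<close> by (intro emeasure_mono) auto
    then have bdd: "bdd_below C" "bdd_above C"
      using interval_bounded_of_finite_measure[of C] conn ne fin C by (auto simp: is_interval_connected_1)
    let ?a = "Inf C" and ?b = "Sup C"
    have ab: "C \<subseteq> {?a..?b}" using bdd by (auto intro: cInf_lower cSup_upper)
    have ba: "{?a<..<?b} \<subseteq> C"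
    proof
      fix y assume "y \<in> {?a<..<?b}"
      then obtain u v where "u \<in> C" "u < y" "v \<in> C" "y < v"
        using ne bdd by (auto simp: cInf_less_iff less_cSup_iff)
      then show "y \<in> C" using conn by (meson connected_contains_Icc atLeastAtMost_iff less_imp_le subsetD)
    qed
    have lt: "?a < ?b"
    proof -
      obtain x e where e: "e > 0" "ball x e \<subseteq> C"
        using comp_open[OF C] ne by (meson ex_in_conv open_contains_ball)
      then have "x - e / 2 \<in> C" "x + e / 2 \<in> C" by (auto simp: dist_real_def subset_iff)
      with ab have "?a \<le> x - e / 2" "x + e / 2 \<le> ?b" by (simp_all only: subset_iff atLeastAtMost_iff)
      with \<open>e > 0\<close> show ?thesis by linarith
    qed
    have "\<not> ennreal (\<nu> * (?b - ?a)) < (\<integral>\<^sup>+ x\<in>{?a..?a + (?b - ?a)}. F x \<partial>lborel)"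
      using left_endpoint_component_notin[OF \<open>open E\<close> C bdd(1)] lt
      unfolding E_def mem_Collect_eq by (metis diff_gt_0_iff_gt)
    then have avg: "(\<integral>\<^sup>+ x\<in>{?a..?a + (?b - ?a)}. F x \<partial>lborel) \<le> ennreal (\<nu> * (?b - ?a))"
      by (rule leI)
    have "(\<integral>\<^sup>+ x\<in>C. F x \<partial>lborel) \<le> (\<integral>\<^sup>+ x\<in>{?a..?a + (?b - ?a)}. F x \<partial>lborel)"
      using ab by (intro nn_integral_mono mult_left_mono) (auto split: split_indicator)
    also have "\<dots> \<le> ennreal (\<nu> * (?b - ?a))"
      by (rule avg)
    also have "\<dots> \<le> ennreal \<nu> * emeasure lborel {?a<..<?b}"
      using lt by (simp add: ennreal_mult'')
    also have "\<dots> \<le> ennreal \<nu> * emeasure lborel C"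
      using ba C by (intro mult_left_mono emeasure_mono) auto
    finally show ?thesis .
  qed
  have "(\<integral>\<^sup>+ x\<in>E. F x \<partial>lborel) = emeasure (density lborel F) E"
    using \<open>open E\<close> by (simp add: emeasure_density)
  also have "\<dots> = (\<integral>\<^sup>+ C. emeasure (density lborel F) C \<partial>count_space (components E))"
    by (subst E_UN, rule emeasure_UN_countable) (use count disj in auto)
  also have "\<dots> \<le> (\<integral>\<^sup>+ C. ennreal \<nu> * emeasure lborel C \<partial>count_space (components E))"
    using comp by (intro nn_integral_mono) (simp add: emeasure_density)
  also have "\<dots> = ennreal \<nu> * (\<integral>\<^sup>+ C. emeasure lborel C \<partial>count_space (components E))"
    by (rule nn_integral_cmult) simp
  also have "(\<integral>\<^sup>+ C. emeasure lborel C \<partial>count_space (components E)) = emeasure lborel E"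
  proof -
    have "emeasure lborel (\<Union>C\<in>components E. C) = (\<integral>\<^sup>+ C. emeasure lborel C \<partial>count_space (components E))"
      by (rule emeasure_UN_countable) (use count disj in auto)
    then show ?thesis unfolding E_UN[symmetric] by (rule sym)
  qed
  finally show "(\<integral>\<^sup>+ x\<in>E. F x \<partial>lborel) \<le> ennreal \<nu> * emeasure lborel E" .
qed

text \<open>Put \<open>\<nu> = l / \<gamma>\<^sub>n\<close> and let \<open>E\<close> be the rising sun set of level \<open>\<nu>\<close>. The level set of the iterate contains
\<open>E\<close>, because every point of \<open>E\<close> is the left end of an interval with mean above \<open>\<nu>\<close>, and up to a null
set it contains \<open>{f > l}\<close>. On \<open>E\<close> the integral of \<open>f\<close> is at most \<open>\<nu> |E|\<close>, and off \<open>E\<close> one has \<open>f \<le> \<nu>\<close>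
almost everywhere. Using the points of \<open>{f > l}\<close> off \<open>E\<close> as well is what yields the factor \<open>\<gamma>\<^sub>n\<close> in
the norm bound; the inclusion of \<open>E\<close> alone would only give its \<open>p\<close>-th power.\<close>
lemma level_set_lower_bound:
  fixes f :: "real \<Rightarrow> real"
  assumes f[measurable]: "f \<in> borel_measurable borel" and nn: "\<And>x. 0 \<le> f x"
    and fin: "\<And>a b. (\<integral>\<^sup>+ y\<in>{a..b}. ennreal (f y) \<partial>lborel) < \<infinity>"
    and l: "0 < l"
  shows "ennreal (gamma_seq n) * (\<integral>\<^sup>+ x. ennreal (f x) * indicator {x. ennreal l < ennreal (f x)} x \<partial>lborel)
     \<le> ennreal l * emeasure lborel {x. ennreal l < hl_iter n (\<lambda>x. ennreal (f x)) x}"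
    (is "_ \<le> ennreal l * emeasure lborel ?S")
proof (cases "gamma_seq n = 0")
  case False
  then have \<gamma>: "0 < gamma_seq n" using gamma_seq_nonneg[of n] by simp
  let ?F = "\<lambda>x. ennreal (f x)"
  define \<nu> where "\<nu> = l / gamma_seq n"
  have \<nu>: "0 < \<nu>" using l \<gamma> by (simp add: \<nu>_def)
  define E where "E = {x. \<exists>h>0. ennreal (\<nu> * h) < (\<integral>\<^sup>+ y\<in>{x..x + h}. ?F y \<partial>lborel)}"
  note le_max = AE_le_hl_max[OF f nn fin]
  have [measurable]: "?S \<in> sets borel" by measurable
  have "E \<subseteq> ?S"
  proof
    fix x assume "x \<in> E"
    then obtain h where h: "0 < h" "ennreal (\<nu> * h) < (\<integral>\<^sup>+ y\<in>{x..x + h}. ?F y \<partial>lborel)"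
      by (auto simp: E_def)
    \<comment> \<open>The exact mean over the interval: being larger than \<open>\<nu>\<close>, it yields the strict inequality.\<close>
    define m where "m = enn2real (\<integral>\<^sup>+ y\<in>{x..x + h}. ?F y \<partial>lborel) / h"
    have m: "ennreal (m * h) = (\<integral>\<^sup>+ y\<in>{x..x + h}. ?F y \<partial>lborel)"
      using h(1) fin[of x "x + h"] by (simp add: m_def ennreal_enn2real_if)
    have "\<nu> * h < m * h"
      using h(2) \<nu> h(1) unfolding m[symmetric] by (simp add: ennreal_less_iff)
    then have "\<nu> < m" using h(1) by simp
    then have "l < m * gamma_seq n" using \<gamma> by (simp add: \<nu>_def divide_less_eq)
    then have "ennreal l < ennreal (m * g_seq n 0)"
      using l by (simp add: ennreal_less_iff gamma_seq_def)
    also have "\<dots> \<le> hl_iter n ?F (x - 0 * h)"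
      using h \<nu> \<open>\<nu> < m\<close> m by (intro hl_iter_ge_g_seq le_max) auto
    finally show "x \<in> ?S" by simp
  qed
  have AE_E: "AE x in lborel. x \<notin> E \<longrightarrow> f x \<le> \<nu>"
    using AE_right_average[OF f nn fin]
  proof eventually_elim
    case (elim x)
    show ?case
    proof (intro impI, rule ccontr)
      assume "x \<notin> E" "\<not> f x \<le> \<nu>"
      then have "(\<nu> + f x) / 2 < f x" "\<nu> < (\<nu> + f x) / 2" by auto
      with elim obtain d where d: "0 < d" "\<And>h. 0 < h \<and> h < d \<Longrightarrow>
          ennreal ((\<nu> + f x) / 2 * h) \<le> (\<integral>\<^sup>+ y\<in>{x..x + h}. ennreal (f y) \<partial>lborel)"
        by blast
      have "ennreal (\<nu> * (d / 2)) < ennreal ((\<nu> + f x) / 2 * (d / 2))"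
        using \<open>\<nu> < (\<nu> + f x) / 2\<close> d(1) \<nu> by (intro ennreal_lessI mult_strict_right_mono mult_pos_pos) auto
      also have "\<dots> \<le> (\<integral>\<^sup>+ y\<in>{x..x + d / 2}. ennreal (f y) \<partial>lborel)"
        using d(1) by (intro d(2)) simp
      finally have "x \<in> E" using d(1) by (auto simp: E_def intro!: exI[of _ "d / 2"])
      with \<open>x \<notin> E\<close> show False by simp
    qed
  qed
  have AE_S: "AE x in lborel. ?F x \<le> hl_iter n ?F x"
    by (rule AE_le_hl_iter[OF le_max])
  show ?thesis
  proof (cases "emeasure lborel ?S = \<infinity>")
    case True
    then show ?thesis using l by (simp add: ennreal_mult_top)
  next
    case False
    have E_fin: "emeasure lborel E < \<infinity>"
      using emeasure_mono[OF \<open>E \<subseteq> ?S\<close>, of lborel] False by (auto simp: less_top)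
    have rs: "open E" "(\<integral>\<^sup>+ x\<in>E. ?F x \<partial>lborel) \<le> ennreal \<nu> * emeasure lborel E"
      using rising_sun_inequality[of ?F \<nu>] E_fin by (auto simp: E_def)
    then have [measurable]: "E \<in> sets borel" by simp
    have "ennreal (gamma_seq n) * (\<integral>\<^sup>+ x. ?F x * indicator {x. ennreal l < ?F x} x \<partial>lborel)
        \<le> ennreal (gamma_seq n) * (\<integral>\<^sup>+ x. ?F x * indicator E x + ennreal \<nu> * indicator (?S - E) x \<partial>lborel)"
    proof (intro mult_left_mono nn_integral_mono_AE)
      show "AE x in lborel. ?F x * indicator {x. ennreal l < ?F x} x
          \<le> ?F x * indicator E x + ennreal \<nu> * indicator (?S - E) x"
        using AE_E AE_S
      proof eventually_elim
        case (elim x)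
        show ?case
        proof (cases "ennreal l < ?F x \<and> x \<notin> E")
          case True
          with elim have "x \<in> ?S - E" "?F x \<le> ennreal \<nu>" by (auto intro: ennreal_leI)
          then show ?thesis by (simp add: indicator_def)
        qed (auto simp: indicator_def)
      qed
    qed simp
    also have "\<dots> = ennreal (gamma_seq n) * ((\<integral>\<^sup>+ x\<in>E. ?F x \<partial>lborel) + ennreal \<nu> * emeasure lborel (?S - E))"
      by (simp add: nn_integral_add nn_integral_cmult_indicator)
    also have "\<dots> \<le> ennreal (gamma_seq n) * (ennreal \<nu> * emeasure lborel E + ennreal \<nu> * emeasure lborel (?S - E))"
      by (intro mult_left_mono add_mono rs) auto
    also have "\<dots> = ennreal (gamma_seq n) * ennreal \<nu> * (emeasure lborel E + emeasure lborel (?S - E))"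
      by (simp add: distrib_left mult.assoc)
    also have "ennreal (gamma_seq n) * ennreal \<nu> = ennreal l"
      using \<gamma> \<nu> by (simp add: \<nu>_def flip: ennreal_mult)
    also have "emeasure lborel E + emeasure lborel (?S - E) = emeasure lborel ?S"
      using \<open>E \<subseteq> ?S\<close> by (subst plus_emeasure) (auto simp: Un_absorb1)
    finally show ?thesis .
  qed
qed simp

lemma ennreal_le_one_plus_powr:
  assumes "1 \<le> p"
  shows "x \<le> 1 + ennreal_powr x p"
proof (cases "x \<le> 1")
  case True
  then show ?thesis by (rule order_trans) simp
next
  case False
  show ?thesis
  proof (cases x)
    case (real r)
    with False have "1 \<le> r" by (simp add: not_le)
    then have "r powr 1 \<le> r powr p" using assms by (intro powr_mono) auto
    then have "x \<le> ennreal_powr x p" using real \<open>1 \<le> r\<close> by (simp add: ennreal_leI)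
    then show ?thesis by (rule order_trans) simp
  qed simp
qed

lemma Lp_imp_locally_integrable:
  assumes "1 \<le> p" and [measurable]: "F \<in> borel_measurable borel" and fin: "Lp_enorm p F < \<infinity>"
  shows "(\<integral>\<^sup>+ y\<in>{a..b}. F y \<partial>lborel) < \<infinity>"
proof -
  have "(\<integral>\<^sup>+ y\<in>{a..b}. F y \<partial>lborel)
      \<le> (\<integral>\<^sup>+ y. indicator {a..b} y + ennreal_powr (F y) p \<partial>lborel)"
    using ennreal_le_one_plus_powr[OF assms(1)]
    by (intro nn_integral_mono) (auto simp: indicator_def)
  also have "\<dots> = emeasure lborel {a..b} + ennreal_powr (Lp_enorm p F) p"
    using assms(1) by (simp add: nn_integral_add Lp_enorm_powr)
  also have "\<dots> < \<infinity>"
    using fin by (simp add: less_top[symmetric] emeasure_lborel_Icc_eq)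
  finally show ?thesis .
qed

text \<open>Both sides are layer cake integrals, with weight 1 for the iterate and weight \<open>f\<close> for \<open>f\<close> itself, so
the level set inequality can be integrated over all levels.\<close>
lemma hl_iter_Lp_lower_bound:
  fixes f :: "real \<Rightarrow> real"
  assumes p: "1 < p" and f[measurable]: "f \<in> borel_measurable borel" and nn: "\<And>x. 0 \<le> f x"
    and fin: "Lp_enorm p (\<lambda>x. ennreal (f x)) < \<infinity>"
  shows "ennreal (gamma_seq n * p / (p - 1)) * (\<integral>\<^sup>+ x. ennreal_powr (ennreal (f x)) p \<partial>lborel)
       \<le> (\<integral>\<^sup>+ x. ennreal_powr (hl_iter n (\<lambda>x. ennreal (f x)) x) p \<partial>lborel)"
proof -
  let ?F = "\<lambda>x. ennreal (f x)"
  let ?w = "\<lambda>l. ennreal ((p - 1) * l powr (p - 1 - 1)) * indicator {0<..} l"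
  let ?I = "\<lambda>l. \<integral>\<^sup>+ x. ?F x * indicator {x. ennreal l < ?F x} x \<partial>lborel"
  have loc: "\<And>a b. (\<integral>\<^sup>+ y\<in>{a..b}. ennreal (f y) \<partial>lborel) < \<infinity>"
    using p fin by (intro Lp_imp_locally_integrable[of p]) auto
  have meas: "(\<lambda>l. ?w l * ?I l) \<in> borel_measurable borel"
  proof -
    have "(\<lambda>l::real. \<integral>\<^sup>+ x. (if ennreal l < ?F x then ?F x else 0) \<partial>lborel) \<in> borel_measurable borel"
      by measurable
    also have "(\<lambda>l::real. \<integral>\<^sup>+ x. (if ennreal l < ?F x then ?F x else 0) \<partial>lborel) = ?I"
      by (auto intro!: nn_integral_cong simp: fun_eq_iff indicator_def)
    finally have [measurable]: "?I \<in> borel_measurable borel" .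
    show ?thesis by measurable
  qed
  have "ennreal (gamma_seq n * p / (p - 1)) * (\<integral>\<^sup>+ x. ennreal_powr (?F x) p \<partial>lborel)
      = ennreal (p / (p - 1) * gamma_seq n) * (\<integral>\<^sup>+ x. ?F x * ennreal_powr (?F x) (p - 1) \<partial>lborel)"
    by (simp add: ennreal_mult_powr mult.commute)
  also have "\<dots> = ennreal (p / (p - 1) * gamma_seq n) * (\<integral>\<^sup>+ l. ?w l * ?I l \<partial>lborel)"
    using p by (subst layer_cake) auto
  also have "\<dots> = (\<integral>\<^sup>+ l. ennreal (p / (p - 1) * gamma_seq n) * (?w l * ?I l) \<partial>lborel)"
    using meas by (intro nn_integral_cmult[symmetric]) simp
  also have "\<dots> = (\<integral>\<^sup>+ l. ennreal (p / (p - 1)) * (?w l * (ennreal (gamma_seq n) * ?I l)) \<partial>lborel)"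
  proof -
    have e: "ennreal (p / (p - 1) * gamma_seq n) = ennreal (p / (p - 1)) * ennreal (gamma_seq n)"
      using p gamma_seq_nonneg[of n] by (intro ennreal_mult) auto
    show ?thesis unfolding e by (simp only: mult_ac)
  qed
  also have "\<dots> \<le> (\<integral>\<^sup>+ l. ennreal (p / (p - 1)) * (?w l *
            (ennreal l * emeasure lborel {x. ennreal l < hl_iter n ?F x})) \<partial>lborel)"
  proof (rule nn_integral_mono)
    fix l :: real
    show "ennreal (p / (p - 1)) * (?w l * (ennreal (gamma_seq n) * ?I l))
       \<le> ennreal (p / (p - 1)) * (?w l * (ennreal l * emeasure lborel {x. ennreal l < hl_iter n ?F x}))"
    proof (cases "0 < l")
      case True
      then show ?thesis by (intro mult_left_mono level_set_lower_bound f nn loc) auto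
    qed simp
  qed
  also have "\<dots> = (\<integral>\<^sup>+ x. ennreal_powr (hl_iter n ?F x) p \<partial>lborel)"
    using p by (intro nn_integral_powr_level_sets[symmetric]) auto
  finally show ?thesis .
qed

section \<open>The maximal theorem and the best constant\<close>

text \<open>Vitali's covering lemma selects disjoint intervals \<open>[j - r, j + r]\<close> with mean above \<open>l\<close> whose fivefold
enlargements still cover the level set.\<close>
lemma weak_type_inequality:
  assumes [measurable]: "F \<in> borel_measurable borel" and l: "0 < l"
  shows "ennreal l * emeasure lborel {x. ennreal l < hl_max F x} \<le> 5 * (\<integral>\<^sup>+ x. F x \<partial>lborel)"
proof (cases "(\<integral>\<^sup>+ x. F x \<partial>lborel) = \<infinity>")
  case True
  then show ?thesis by (simp add: ennreal_mult_top)
next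
  case False
  define m where "m = enn2real (\<integral>\<^sup>+ x. F x \<partial>lborel)"
  have m: "(\<integral>\<^sup>+ x. F x \<partial>lborel) = ennreal m" using False by (simp add: m_def ennreal_enn2real_if)
  let ?K = "{x. ennreal l < hl_max F x}"
  have [measurable]: "?K \<in> sets borel" by measurable
  have "\<forall>x\<in>?K. \<exists>r>0. ennreal (2 * r * l) < (\<integral>\<^sup>+ y\<in>cball x r. F y \<partial>lborel)"
    using l by (auto simp: hl_max_def less_SUP_iff ennreal_less_divide_iff cball_eq_atLeastAtMost simp flip: ennreal_mult)
  then obtain r where r: "\<And>x. x \<in> ?K \<Longrightarrow> 0 < r x"
      "\<And>x. x \<in> ?K \<Longrightarrow> ennreal (2 * r x * l) < (\<integral>\<^sup>+ y\<in>cball x (r x). F y \<partial>lborel)"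
    by metis
  \<comment> \<open>The radii are bounded, since a large interval would carry more than the whole integral.\<close>
  have bound: "0 < r x \<and> r x \<le> m / (2 * l)" if "x \<in> ?K" for x
  proof -
    have "ennreal (2 * r x * l) < ennreal m"
      using r(2)[OF that] unfolding m[symmetric]
      by (rule order_less_le_trans) (auto intro!: nn_integral_mono simp: indicator_def)
    then show ?thesis using r(1)[OF that] l by (simp add: ennreal_less_iff field_simps)
  qed
  obtain C where C: "countable C" "C \<subseteq> ?K"
      "pairwise (\<lambda>i j. disjnt (cball i (r i)) (cball j (r j))) C"
      "\<And>i. i \<in> ?K \<Longrightarrow> \<exists>j. j \<in> C \<and> \<not> disjnt (cball i (r i)) (cball j (r j)) \<and> cball i (r i) \<subseteq> ball j (5 * r j)"
    by (rule Vitali_covering_lemma_cballs_balls[OF bound, where a = "\<lambda>x. x"]) (blast intro: that)+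
  have "ennreal l * emeasure lborel ?K = ennreal l * (\<integral>\<^sup>+ x. indicator ?K x \<partial>lborel)"
    by simp
  also have "\<dots> \<le> ennreal l * (\<integral>\<^sup>+ x. (\<integral>\<^sup>+ j. indicator (ball j (5 * r j)) x \<partial>count_space C) \<partial>lborel)"
  proof (intro mult_left_mono nn_integral_mono)
    fix x
    show "indicator ?K x \<le> (\<integral>\<^sup>+ j. indicator (ball j (5 * r j)) x \<partial>count_space C)"
    proof (cases "x \<in> ?K")
      case True
      then obtain j where j: "j \<in> C" "cball x (r x) \<subseteq> ball j (5 * r j)" using C(4) by blast
      then have "x \<in> ball j (5 * r j)" using r(1)[OF True] by (auto simp: subset_iff)
      then have "indicator ?K x = (indicator (ball j (5 * r j)) x :: ennreal)" using True by simp
      also have "\<dots> \<le> (\<integral>\<^sup>+ j. indicator (ball j (5 * r j)) x \<partial>count_space C)"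
        by (rule nn_integral_ge_point[OF j(1)])
      finally show ?thesis .
    qed simp
  qed simp
  also have "(\<integral>\<^sup>+ x. (\<integral>\<^sup>+ j. indicator (ball j (5 * r j)) x \<partial>count_space C) \<partial>lborel)
      = (\<integral>\<^sup>+ j. (\<integral>\<^sup>+ x. indicator (ball j (5 * r j)) x \<partial>lborel) \<partial>count_space C)"
    by (rule nn_integral_count_space_nn_integral[OF C(1)]) (rule borel_measurable_indicator, simp)
  also have "ennreal l * \<dots> = (\<integral>\<^sup>+ j. ennreal l * (\<integral>\<^sup>+ x. indicator (ball j (5 * r j)) x \<partial>lborel) \<partial>count_space C)"
    by (rule nn_integral_cmult[symmetric]) simp
  also have "\<dots> \<le> (\<integral>\<^sup>+ j. 5 * (\<integral>\<^sup>+ y\<in>cball j (r j). F y \<partial>lborel) \<partial>count_space C)"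
  proof (rule nn_integral_mono)
    fix j assume "j \<in> space (count_space C)"
    then have j: "j \<in> ?K" using C(2) by auto
    have "ennreal l * (\<integral>\<^sup>+ x. indicator (ball j (5 * r j)) x \<partial>lborel) = ennreal l * ennreal (10 * r j)"
      using r(1)[OF j] by (simp add: ball_eq_greaterThanLessThan)
    also have "\<dots> = 5 * ennreal (2 * r j * l)"
      using r(1)[OF j] l by (simp add: mult_ac flip: ennreal_mult ennreal_numeral)
    also have "\<dots> \<le> 5 * (\<integral>\<^sup>+ y\<in>cball j (r j). F y \<partial>lborel)"
      using r(2)[OF j] by (intro mult_left_mono) auto
    finally show "ennreal l * (\<integral>\<^sup>+ x. indicator (ball j (5 * r j)) x \<partial>lborel)
        \<le> 5 * (\<integral>\<^sup>+ y\<in>cball j (r j). F y \<partial>lborel)" .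
  qed
  also have "\<dots> = 5 * (\<integral>\<^sup>+ j. emeasure (density lborel F) (cball j (r j)) \<partial>count_space C)"
    by (subst nn_integral_cmult) (auto simp: emeasure_density)
  also have "(\<integral>\<^sup>+ j. emeasure (density lborel F) (cball j (r j)) \<partial>count_space C)
      = emeasure (density lborel F) (\<Union>j\<in>C. cball j (r j))"
    using C(3) by (intro emeasure_UN_countable[symmetric] C(1))
      (auto simp: disjoint_family_on_def pairwise_def disjnt_def)
  also have "\<dots> \<le> emeasure (density lborel F) (space (density lborel F))"
    by (rule emeasure_space)
  also have "\<dots> = (\<integral>\<^sup>+ x. F x \<partial>lborel)"
    by (simp add: emeasure_density)
  finally show ?thesis by (simp add: mult_left_mono)
qed

text \<open>The part of \<open>F\<close> below \<open>l / 2\<close> raises the maximal function by at most \<open>l / 2\<close>, so the weak type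
inequality for the part above \<open>l / 2\<close> bounds the level sets; the layer cake formula sums these bounds
over all \<open>l\<close>.\<close>
lemma hl_max_Lp_upper_bound:
  assumes p: "1 < p" and [measurable]: "F \<in> borel_measurable borel"
  shows "(\<integral>\<^sup>+ x. ennreal_powr (hl_max F x) p \<partial>lborel)
       \<le> ennreal (10 * (p / (p - 1)) * 2 powr (p - 1)) * (\<integral>\<^sup>+ x. ennreal_powr (F x) p \<partial>lborel)"
proof -
  let ?w = "\<lambda>l. ennreal ((p - 1) * l powr (p - 1 - 1)) * indicator {0<..} l"
  let ?I = "\<lambda>l. \<integral>\<^sup>+ x. F x * indicator {x. ennreal l < 2 * F x} x \<partial>lborel"
  have trunc: "ennreal l * emeasure lborel {x. ennreal l < hl_max F x} \<le> 10 * ?I l" if l: "0 < l" for l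
  proof -
    let ?G = "\<lambda>x. F x * indicator {x. ennreal l < 2 * F x} x"
    have [measurable]: "{x. ennreal l < hl_max F x} \<in> sets borel" by measurable
    have half: "ennreal (l / 2) + ennreal (l / 2) = ennreal l"
      using l by (simp flip: ennreal_plus)
    have "{x. ennreal l < hl_max F x} \<subseteq> {x. ennreal (l / 2) < hl_max ?G x}"
    proof safe
      fix x assume x: "ennreal l < hl_max F x"
      have "hl_max F x \<le> hl_max (\<lambda>x. ?G x + ennreal (l / 2)) x"
      proof (intro hl_max_mono_AE AE_I2)
        fix y
        show "F y \<le> ?G y + ennreal (l / 2)"
        proof (cases "ennreal l < 2 * F y")
          case False
          then have "F y \<le> ennreal (l / 2)"
            using l by (cases "F y") (auto simp: not_less ennreal_mult_top simp flip: ennreal_mult ennreal_numeral)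
          then show ?thesis using False by simp
        qed simp
      qed
      also have "\<dots> \<le> hl_max ?G x + hl_max (\<lambda>x. ennreal (l / 2)) x"
        by (intro hl_max_add) measurable
      also have "\<dots> \<le> hl_max ?G x + ennreal (l / 2)"
        by (intro add_left_mono hl_max_const_le)
      finally have "ennreal (l / 2) + ennreal (l / 2) < hl_max ?G x + ennreal (l / 2)"
        using x half by simp
      then show "ennreal (l / 2) < hl_max ?G x"
        by (meson add_right_mono not_le)
    qed
    then have "ennreal (l / 2) * emeasure lborel {x. ennreal l < hl_max F x}
        \<le> ennreal (l / 2) * emeasure lborel {x. ennreal (l / 2) < hl_max ?G x}"
      by (intro mult_left_mono emeasure_mono) auto
    also have "\<dots> \<le> 5 * ?I l"
      using l by (intro weak_type_inequality) auto
    finally have "2 * (ennreal (l / 2) * emeasure lborel {x. ennreal l < hl_max F x}) \<le> 2 * (5 * ?I l)"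
      by (rule mult_left_mono) simp
    moreover have "2 * (ennreal (l / 2) * X) = ennreal l * X" for X
      using half by (metis mult.assoc mult_2)
    ultimately show ?thesis by (simp flip: mult.assoc)
  qed
  have "(\<integral>\<^sup>+ x. ennreal_powr (hl_max F x) p \<partial>lborel)
      = (\<integral>\<^sup>+ l. ennreal (p / (p - 1)) * (?w l *
            (ennreal l * emeasure lborel {x. ennreal l < hl_max F x})) \<partial>lborel)"
    using p by (intro nn_integral_powr_level_sets) auto
  also have "\<dots> \<le> (\<integral>\<^sup>+ l. ennreal (10 * (p / (p - 1))) * (?w l * ?I l) \<partial>lborel)"
  proof (rule nn_integral_mono)
    fix l :: real
    show "ennreal (p / (p - 1)) * (?w l * (ennreal l * emeasure lborel {x. ennreal l < hl_max F x}))
        \<le> ennreal (10 * (p / (p - 1))) * (?w l * ?I l)"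
    proof (cases "0 < l")
      case True
      have "ennreal (p / (p - 1)) * (?w l * (ennreal l * emeasure lborel {x. ennreal l < hl_max F x}))
          \<le> ennreal (p / (p - 1)) * (?w l * (10 * ?I l))"
        using trunc[OF True] by (intro mult_left_mono) auto
      also have "\<dots> = ennreal (10 * (p / (p - 1))) * (?w l * ?I l)"
        using p by (subst ennreal_mult) (auto simp: mult_ac)
      finally show ?thesis .
    qed simp
  qed
  also have "\<dots> = ennreal (10 * (p / (p - 1))) * (\<integral>\<^sup>+ l. ?w l * ?I l \<partial>lborel)"
  proof (rule nn_integral_cmult)
    have "(\<lambda>l::real. \<integral>\<^sup>+ x. (if ennreal l < 2 * F x then F x else 0) \<partial>lborel) \<in> borel_measurable borel"
      by measurable
    also have "(\<lambda>l::real. \<integral>\<^sup>+ x. (if ennreal l < 2 * F x then F x else 0) \<partial>lborel) = ?I"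
      by (auto intro!: nn_integral_cong simp: fun_eq_iff indicator_def)
    finally have [measurable]: "?I \<in> borel_measurable borel" .
    show "(\<lambda>l. ?w l * ?I l) \<in> borel_measurable lborel" by measurable
  qed
  also have "(\<integral>\<^sup>+ l. ?w l * ?I l \<partial>lborel) = (\<integral>\<^sup>+ x. F x * ennreal_powr (2 * F x) (p - 1) \<partial>lborel)"
    using p by (intro layer_cake) auto
  also have "\<dots> = (\<integral>\<^sup>+ x. ennreal (2 powr (p - 1)) * ennreal_powr (F x) p \<partial>lborel)"
  proof (rule nn_integral_cong)
    fix x
    have "F x * ennreal_powr (2 * F x) (p - 1) = ennreal_powr 2 (p - 1) * (F x * ennreal_powr (F x) (p - 1))"
      by (simp add: ennreal_powr_mult mult_ac)
    also have "ennreal_powr 2 (p - 1) = ennreal (2 powr (p - 1))"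
      using ennreal_powr_ennreal[of 2 "p - 1"] by simp
    finally show "F x * ennreal_powr (2 * F x) (p - 1) = ennreal (2 powr (p - 1)) * ennreal_powr (F x) p"
      by (simp add: ennreal_mult_powr)
  qed
  also have "\<dots> = ennreal (2 powr (p - 1)) * (\<integral>\<^sup>+ x. ennreal_powr (F x) p \<partial>lborel)"
    by (rule nn_integral_cmult) simp
  also have "ennreal (10 * (p / (p - 1))) * (ennreal (2 powr (p - 1)) * (\<integral>\<^sup>+ x. ennreal_powr (F x) p \<partial>lborel))
      = ennreal (10 * (p / (p - 1)) * 2 powr (p - 1)) * (\<integral>\<^sup>+ x. ennreal_powr (F x) p \<partial>lborel)"
  proof -
    have "ennreal (10 * (p / (p - 1)) * 2 powr (p - 1)) = ennreal (10 * (p / (p - 1))) * ennreal (2 powr (p - 1))"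
      using p by (intro ennreal_mult) auto
    then show ?thesis by (simp only: mult.assoc)
  qed
  finally show ?thesis .
qed

text \<open>Maximal functions and norms depend only on the almost everywhere class, so a Lebesgue measurable
function may be replaced by a nonnegative Borel function.\<close>
lemma Lp_space_borel_representative:
  assumes "1 < p" "f \<in> Lp_space p"
  obtains g :: "real \<Rightarrow> real" where "g \<in> borel_measurable borel" "\<And>x. 0 \<le> g x"
    "centered_maximal f = hl_max (\<lambda>x. ennreal (g x))"
    "Lp_norm p f = Lp_enorm p (\<lambda>x. ennreal (g x))"
    "Lp_enorm p (\<lambda>x. ennreal (g x)) < \<infinity>"
proof -
  have "f \<in> borel_measurable lebesgue" using assms by (simp add: Lp_space_def)
  then obtain g where g: "g \<in> borel_measurable lborel" "AE x in lborel. f x = g x"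
    by (auto dest: completion_ex_borel_measurable_real)
  then have AE: "AE x in lborel. ennreal \<bar>f x\<bar> = ennreal \<bar>g x\<bar>" by auto
  show ?thesis
  proof (rule that[of "\<lambda>x. \<bar>g x\<bar>"])
    show "(\<lambda>x. \<bar>g x\<bar>) \<in> borel_measurable borel" using g(1) by simp
    show "centered_maximal f = hl_max (\<lambda>x. ennreal \<bar>g x\<bar>)"
      unfolding centered_maximal_eq_hl_max by (rule hl_max_cong_AE[OF AE])
    show "Lp_norm p f = Lp_enorm p (\<lambda>x. ennreal \<bar>g x\<bar>)"
      unfolding Lp_norm_def using AE assms(1)
      by (intro antisym Lp_enorm_mono_AE) auto
    then show "Lp_enorm p (\<lambda>x. ennreal \<bar>g x\<bar>) < \<infinity>"
      using assms by (simp add: Lp_space_def)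
  qed simp
qed

lemma borel_in_Lp_space:
  assumes "f \<in> borel_measurable borel" "Lp_enorm p (\<lambda>x. ennreal \<bar>f x\<bar>) < \<infinity>"
  shows "f \<in> Lp_space p"
proof -
  have "f \<in> borel_measurable lborel" using assms(1) by simp
  then have "f \<in> borel_measurable lebesgue" by (rule measurable_completion)
  then show ?thesis using assms(2) by (simp add: Lp_space_def Lp_norm_def)
qed

lemma strong_type_constant_exists:
  assumes p: "1 < p"
  shows "\<exists>C. strong_type_constant p C"
proof -
  define K where "K = 10 * (p / (p - 1)) * 2 powr (p - 1)"
  have K: "0 \<le> K" using p by (simp add: K_def)
  have "Lp_enorm p (centered_maximal f) \<le> ennreal (K powr (1 / p)) * Lp_norm p f" if f: "f \<in> Lp_space p" for f
  proof -
    obtain g where g: "g \<in> borel_measurable borel" "\<And>x. 0 \<le> g x"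
        "centered_maximal f = hl_max (\<lambda>x. ennreal (g x))" "Lp_norm p f = Lp_enorm p (\<lambda>x. ennreal (g x))"
      using Lp_space_borel_representative[OF p f] by metis
    have "(\<integral>\<^sup>+ x. ennreal_powr (hl_max (\<lambda>x. ennreal (g x)) x) p \<partial>lborel)
        \<le> ennreal K * (\<integral>\<^sup>+ x. ennreal_powr (ennreal (g x)) p \<partial>lborel)"
      unfolding K_def using p g(1) by (intro hl_max_Lp_upper_bound) auto
    then have "ennreal_powr (\<integral>\<^sup>+ x. ennreal_powr (hl_max (\<lambda>x. ennreal (g x)) x) p \<partial>lborel) (1 / p)
        \<le> ennreal_powr (ennreal K * (\<integral>\<^sup>+ x. ennreal_powr (ennreal (g x)) p \<partial>lborel)) (1 / p)"
      using p by (intro ennreal_powr_mono) auto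
    then show ?thesis unfolding g(3,4) ennreal_powr_mult Lp_enorm_lborel using K by simp
  qed
  then have "strong_type_constant p (K powr (1 / p))" by (simp add: strong_type_constant_def)
  then show ?thesis by blast
qed

text \<open>The infimum defining \<open>best_constant\<close> is attained. Non-emptiness of the set of admissible constants is
the maximal theorem.\<close>
lemma strong_type_best_constant:
  assumes p: "1 < p"
  shows "strong_type_constant p (best_constant p)"
proof -
  let ?S = "{C. strong_type_constant p C}"
  have ne: "?S \<noteq> {}" using strong_type_constant_exists[OF p] by blast
  have nonneg: "0 \<le> best_constant p"
    unfolding best_constant_def using ne by (intro cInf_greatest) (auto simp: strong_type_constant_def)
  have "Lp_enorm p (centered_maximal f) \<le> ennreal (best_constant p) * Lp_norm p f" if f: "f \<in> Lp_space p" for f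
  proof -
    obtain b where b: "Lp_norm p f = ennreal b" "0 \<le> b"
      using f by (cases "Lp_norm p f") (auto simp: Lp_space_def)
    have le: "Lp_enorm p (centered_maximal f) \<le> ennreal (C * b)" if "C \<in> ?S" for C
      using that f b by (auto simp: strong_type_constant_def ennreal_mult)
    then obtain a where a: "Lp_enorm p (centered_maximal f) = ennreal a" "0 \<le> a"
      using ne by (cases "Lp_enorm p (centered_maximal f)") (auto simp: top_unique)
    have aC: "a \<le> C * b" if "C \<in> ?S" for C
      using le[OF that] a b that by (auto simp: strong_type_constant_def ennreal_le_iff)
    have "a \<le> best_constant p * b"
    proof (cases "b = 0")
      case True
      then show ?thesis using aC ne by auto
    next
      case False
      then have "0 < b" using b by simp
      then have "a / b \<le> best_constant p"
        unfolding best_constant_def using ne aC by (intro cInf_greatest) (auto simp: divide_le_eq)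
      then show ?thesis using \<open>0 < b\<close> by (simp add: divide_le_eq)
    qed
    then show ?thesis using a b nonneg by (simp add: ennreal_leI flip: ennreal_mult)
  qed
  then show ?thesis using nonneg by (simp add: strong_type_constant_def)
qed

text \<open>A function of finite norm is finite almost everywhere, hence agrees with a real-valued one to which
the best constant applies.\<close>
lemma Lp_enorm_hl_max_le:
  assumes p: "1 < p" and [measurable]: "F \<in> borel_measurable borel" and fin: "Lp_enorm p F < \<infinity>"
  shows "Lp_enorm p (hl_max F) \<le> ennreal (best_constant p) * Lp_enorm p F"
proof -
  have "(\<integral>\<^sup>+ x. ennreal_powr (F x) p \<partial>lborel) \<noteq> \<infinity>"
    using fin p by (simp flip: Lp_enorm_powr)
  then have "AE x in lborel. ennreal_powr (F x) p \<noteq> \<infinity>"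
    by (intro nn_integral_PInf_AE) auto
  then have AE: "AE x in lborel. F x = ennreal \<bar>enn2real (F x)\<bar>"
    by eventually_elim (simp add: ennreal_enn2real_if)
  have norm: "Lp_enorm p F = Lp_enorm p (\<lambda>x. ennreal \<bar>enn2real (F x)\<bar>)"
    using AE p by (intro antisym Lp_enorm_mono_AE) auto
  have "(\<lambda>x. enn2real (F x)) \<in> Lp_space p"
    using fin norm by (intro borel_in_Lp_space) auto
  then have "Lp_enorm p (centered_maximal (\<lambda>x. enn2real (F x)))
      \<le> ennreal (best_constant p) * Lp_norm p (\<lambda>x. enn2real (F x))"
    using strong_type_best_constant[OF p] by (auto simp: strong_type_constant_def)
  moreover have "hl_max F = centered_maximal (\<lambda>x. enn2real (F x))"
    unfolding centered_maximal_eq_hl_max by (rule hl_max_cong_AE[OF AE])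
  ultimately show ?thesis by (simp add: norm Lp_norm_def)
qed

lemma Lp_enorm_hl_iter_le:
  assumes p: "1 < p" and [measurable]: "F \<in> borel_measurable borel" and fin: "Lp_enorm p F < \<infinity>"
  shows "Lp_enorm p (hl_iter n F) \<le> ennreal (best_constant p ^ n) * Lp_enorm p F"
proof (induction n)
  case (Suc n)
  have A: "0 \<le> best_constant p"
    using strong_type_best_constant[OF p] by (simp add: strong_type_constant_def)
  have "Lp_enorm p (hl_iter n F) < \<infinity>"
    using Suc fin by (auto simp: ennreal_mult_less_top less_top intro: order_le_less_trans)
  then have "Lp_enorm p (hl_iter (Suc n) F) \<le> ennreal (best_constant p) * Lp_enorm p (hl_iter n F)"
    unfolding hl_iter_Suc by (intro Lp_enorm_hl_max_le p) auto
  also have "\<dots> \<le> ennreal (best_constant p) * (ennreal (best_constant p ^ n) * Lp_enorm p F)"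
    by (intro mult_left_mono Suc) simp
  also have "\<dots> = ennreal (best_constant p ^ Suc n) * Lp_enorm p F"
    using A by (simp add: ennreal_mult mult.assoc)
  finally show ?case .
qed simp

section \<open>Comparing the maximal function with its iterates\<close>

lemma Lp_enorm_hl_iter_ge:
  fixes g :: "real \<Rightarrow> real"
  assumes p: "1 < p" and g: "g \<in> borel_measurable borel" "\<And>x. 0 \<le> g x"
    and fin: "Lp_enorm p (\<lambda>x. ennreal (g x)) < \<infinity>"
  shows "ennreal ((gamma_seq n * p / (p - 1)) powr (1 / p)) * Lp_enorm p (\<lambda>x. ennreal (g x))
       \<le> Lp_enorm p (hl_iter n (\<lambda>x. ennreal (g x)))"
proof -
  have nn: "0 \<le> gamma_seq n * p / (p - 1)" using p gamma_seq_nonneg[of n] by simp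
  have "ennreal_powr (ennreal (gamma_seq n * p / (p - 1)) * (\<integral>\<^sup>+ x. ennreal_powr (ennreal (g x)) p \<partial>lborel)) (1 / p)
      \<le> ennreal_powr (\<integral>\<^sup>+ x. ennreal_powr (hl_iter n (\<lambda>x. ennreal (g x)) x) p \<partial>lborel) (1 / p)"
    using p by (intro ennreal_powr_mono hl_iter_Lp_lower_bound g fin) auto
  then show ?thesis unfolding Lp_enorm_lborel ennreal_powr_mult using nn by simp
qed

text \<open>Otherwise no iterate could increase a norm, while \<open>Lp_enorm_hl_iter_ge\<close> with \<open>\<gamma>\<^sub>n > (p - 1) / p\<close> says
that a late iterate increases every finite nonzero norm. The strict inequality
makes the quotient in the theorem the reciprocal of a genuine geometric sum.\<close>
lemma best_constant_greater_1:
  assumes p: "1 < p"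
  shows "1 < best_constant p"
proof (rule ccontr)
  assume "\<not> 1 < best_constant p"
  then have A: "0 \<le> best_constant p" "best_constant p \<le> 1"
    using strong_type_best_constant[OF p] by (auto simp: strong_type_constant_def)
  obtain n where n: "(p - 1) / p < gamma_seq n"
    using eventually_gamma_seq_greater[of "(p - 1) / p"] p by (auto simp: eventually_sequentially)
  \<comment> \<open>Any nonzero function of finite norm would do.\<close>
  define g :: "real \<Rightarrow> real" where "g = indicator {0..1}"
  have "(\<integral>\<^sup>+ x. ennreal_powr (ennreal (g x)) p \<partial>lborel) = (\<integral>\<^sup>+ x. indicator {0..1::real} x \<partial>lborel)"
    by (intro nn_integral_cong) (auto simp: g_def indicator_def)
  then have norm: "Lp_enorm p (\<lambda>x. ennreal (g x)) = 1"
    using ennreal_powr_ennreal[of 1 "1 / p"] by (simp add: Lp_enorm_lborel)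
  have "ennreal ((gamma_seq n * p / (p - 1)) powr (1 / p)) \<le> Lp_enorm p (hl_iter n (\<lambda>x. ennreal (g x)))"
    using Lp_enorm_hl_iter_ge[of p g n] p norm by (simp add: g_def)
  also have "\<dots> \<le> ennreal (best_constant p ^ n)"
    using Lp_enorm_hl_iter_le[of p "\<lambda>x. ennreal (g x)" n] p norm by (simp add: g_def)
  also have "\<dots> \<le> ennreal 1"
    using A by (intro ennreal_leI power_le_one) auto
  finally have "(gamma_seq n * p / (p - 1)) powr (1 / p) \<le> 1" by simp
  moreover have "1 < gamma_seq n * p / (p - 1)" using n p by (simp add: field_simps)
  then have "1 < (gamma_seq n * p / (p - 1)) powr (1 / p)"
    using p by (intro gr_one_powr) auto
  ultimately show False by simp
qed

text \<open>Sublinearity propagates the first increment \<open>H = M F - F\<close>: each further step of the iteration adds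
at most one more iterate of \<open>H\<close>. Stating this with sums avoids differences of functions that may be
infinite.\<close>
lemma hl_iter_le_sum:
  assumes [measurable]: "F \<in> borel_measurable borel" "H \<in> borel_measurable borel"
    and eq: "AE x in lborel. hl_max F x = F x + H x"
  shows "AE x in lborel. hl_iter n F x \<le> F x + (\<Sum>j<n. hl_iter j H x)"
proof (induction n)
  case (Suc n)
  from eq show ?case
  proof eventually_elim
    case (elim x)
    have "hl_iter (Suc n) F x \<le> hl_max (\<lambda>x. F x + (\<Sum>j<n. hl_iter j H x)) x"
      unfolding hl_iter_Suc by (rule hl_max_mono_AE[OF Suc])
    also have "\<dots> \<le> hl_max F x + hl_max (\<lambda>x. \<Sum>j<n. hl_iter j H x) x"
      by (rule hl_max_add) measurable
    also have "\<dots> \<le> hl_max F x + (\<Sum>j<n. hl_max (hl_iter j H) x)"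
      by (intro add_left_mono hl_max_sum) measurable
    also have "\<dots> = F x + (\<Sum>j<Suc n. hl_iter j H x)"
      unfolding sum.lessThan_Suc_shift by (simp add: elim hl_iter_Suc add.assoc)
    finally show ?case .
  qed
qed simp

text \<open>By \<open>hl_iter_le_sum\<close> and Minkowski's inequality, \<open>\<parallel>M\<^sup>n f\<parallel> \<le> \<parallel>f\<parallel> + (1 + A + \<dots> + A\<^sup>n\<^sup>-\<^sup>1) \<parallel>H\<parallel>\<close>, whereas
\<open>\<parallel>M\<^sup>n f\<parallel> \<ge> (\<gamma>\<^sub>n p / (p - 1))\<^bsup>1/p\<^esup> \<parallel>f\<parallel>\<close>. This bounds \<open>\<parallel>H\<parallel>\<close> from below by a multiple of \<open>\<parallel>f\<parallel>\<close>, and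
\<open>\<parallel>M f\<parallel>\<^sup>p \<ge> \<parallel>f\<parallel>\<^sup>p + \<parallel>H\<parallel>\<^sup>p\<close> turns that into the claim.\<close>
lemma Lp_enorm_hl_max_ge:
  assumes p: "1 < p" and c1: "1 \<le> gamma_seq n * p / (p - 1)" and f: "f \<in> Lp_space p" and e: "0 \<le> \<epsilon>"
    and eq: "(1 + \<epsilon>) powr p = 1 + ((best_constant p - 1) / (best_constant p ^ n - 1)) powr p *
                     ((gamma_seq n * p / (p - 1)) powr (1 / p) - 1) powr p"
  shows "ennreal (1 + \<epsilon>) * Lp_norm p f \<le> Lp_enorm p (centered_maximal f)"
proof -
  let ?A = "best_constant p" and ?c = "(gamma_seq n * p / (p - 1)) powr (1 / p)"
  have A: "1 < ?A" by (rule best_constant_greater_1[OF p])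
  have c: "1 \<le> ?c" using c1 p by (intro ge_one_powr_ge_zero) auto
  obtain g where g[measurable]: "g \<in> borel_measurable borel" and g0: "\<And>x. 0 \<le> g x"
      and M: "centered_maximal f = hl_max (\<lambda>x. ennreal (g x))" and N: "Lp_norm p f = Lp_enorm p (\<lambda>x. ennreal (g x))"
      and fin: "Lp_enorm p (\<lambda>x. ennreal (g x)) < \<infinity>"
    using Lp_space_borel_representative[OF p f] by metis
  let ?F = "\<lambda>x. ennreal (g x)"
  define H where "H = (\<lambda>x. hl_max ?F x - ?F x)"
  have [measurable]: "H \<in> borel_measurable borel" unfolding H_def by measurable
  have loc: "\<And>a b. (\<integral>\<^sup>+ y\<in>{a..b}. ennreal (g y) \<partial>lborel) < \<infinity>"
    using p fin by (intro Lp_imp_locally_integrable[of p]) auto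
  have FH: "AE x in lborel. hl_max ?F x = ?F x + H x"
    using AE_le_hl_max[OF g g0 loc]
    by eventually_elim (simp add: H_def ennreal_ineq_diff_add[symmetric])
  obtain a where a: "Lp_enorm p ?F = ennreal a" "0 \<le> a"
    using fin by (cases "Lp_enorm p ?F") auto
  have "Lp_enorm p (hl_max ?F) \<le> ennreal ?A * ennreal a"
    using Lp_enorm_hl_max_le[OF p _ fin] a by simp
  also have "\<dots> < top" by (simp add: ennreal_mult_less_top)
  finally obtain d where d: "Lp_enorm p (hl_max ?F) = ennreal d" "0 \<le> d"
    by (cases "Lp_enorm p (hl_max ?F)") auto
  have "Lp_enorm p H \<le> Lp_enorm p (hl_max ?F)"
    using p by (intro Lp_enorm_mono_AE) (auto simp: H_def diff_le_self_ennreal)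
  then obtain b where b: "Lp_enorm p H = ennreal b" "0 \<le> b"
    using d by (cases "Lp_enorm p H") (auto simp: top_unique)
  have n: "0 < n"
  proof (rule ccontr)
    assume "\<not> 0 < n"
    then show False using c1 by (simp add: gamma_seq_def)
  qed
  then have An: "1 < ?A ^ n" using A by simp
  let ?S = "(?A ^ n - 1) / (?A - 1)"
  have S: "(\<Sum>j<n. ?A ^ j) = ?S" using A by (simp add: geometric_sum)
  have Spos: "0 < ?S" using A An by simp
  have "ennreal (?c * a) \<le> Lp_enorm p (hl_iter n ?F)"
    using Lp_enorm_hl_iter_ge[OF p g g0 fin, of n] a by (simp add: ennreal_mult)
  also have "\<dots> \<le> Lp_enorm p (\<lambda>x. ?F x + (\<Sum>j<n. hl_iter j H x))"
    using p by (intro Lp_enorm_mono_AE hl_iter_le_sum FH) auto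
  also have "\<dots> \<le> Lp_enorm p ?F + Lp_enorm p (\<lambda>x. \<Sum>j<n. hl_iter j H x)"
    using p by (intro Minkowski_Lp_enorm) auto
  also have "\<dots> \<le> Lp_enorm p ?F + (\<Sum>j<n. Lp_enorm p (hl_iter j H))"
    using p by (intro add_left_mono Lp_enorm_sum_le) auto
  also have "\<dots> \<le> ennreal a + (\<Sum>j<n. ennreal (?A ^ j * b))"
    using Lp_enorm_hl_iter_le[OF p, of H] a b A
    by (intro add_mono sum_mono) (auto simp: ennreal_mult)
  also have "\<dots> = ennreal (a + (\<Sum>j<n. ?A ^ j * b))"
    using a b A by (simp add: sum_ennreal sum_nonneg)
  finally have "?c * a \<le> a + (\<Sum>j<n. ?A ^ j * b)"
    using a b A by (subst (asm) ennreal_le_iff) (auto intro!: add_nonneg_nonneg sum_nonneg)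
  also have "(\<Sum>j<n. ?A ^ j * b) = ?S * b"
    using S by (simp flip: sum_distrib_right)
  finally have "(?c - 1) * a \<le> ?S * b" by (simp add: algebra_simps)
  then have "(?c - 1) * a / ?S \<le> b"
    by (simp only: pos_divide_le_eq[OF Spos] mult.commute[of b])
  moreover have "(?c - 1) * a / ?S = (?A - 1) / (?A ^ n - 1) * (?c - 1) * a"
    by (simp add: mult_ac)
  ultimately have ba: "(?A - 1) / (?A ^ n - 1) * (?c - 1) * a \<le> b"
    by (simp only:)
  have "(1 + \<epsilon>) powr p * a powr p = a powr p + ((?A - 1) / (?A ^ n - 1) * (?c - 1) * a) powr p"
    unfolding eq powr_mult distrib_right by (simp only: mult_1)
  also have "\<dots> \<le> a powr p + b powr p"
    using ba p A An c a by (intro add_left_mono powr_mono2) auto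
  finally have ab: "((1 + \<epsilon>) * a) powr p \<le> a powr p + b powr p"
    using e a by (simp add: powr_mult)
  have "ennreal (((1 + \<epsilon>) * a) powr p) \<le> ennreal (a powr p + b powr p)"
    by (rule ennreal_leI[OF ab])
  also have "\<dots> = ennreal_powr (Lp_enorm p ?F) p + ennreal_powr (Lp_enorm p H) p"
    using a b by simp
  also have "\<dots> = (\<integral>\<^sup>+ x. ennreal_powr (?F x) p + ennreal_powr (H x) p \<partial>lborel)"
    using p by (simp add: Lp_enorm_powr nn_integral_add del: ennreal_powr_ennreal)
  also have "\<dots> \<le> (\<integral>\<^sup>+ x. ennreal_powr (?F x + H x) p \<partial>lborel)"
    using p by (intro nn_integral_mono ennreal_powr_add_superadditive) auto
  also have "\<dots> = (\<integral>\<^sup>+ x. ennreal_powr (hl_max ?F x) p \<partial>lborel)"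
    using FH by (intro nn_integral_cong_AE) auto
  also have "\<dots> = ennreal (d powr p)"
    using p d by (simp flip: Lp_enorm_powr)
  finally have "((1 + \<epsilon>) * a) powr p \<le> d powr p" by simp
  then have "(1 + \<epsilon>) * a \<le> d"
    using powr_less_mono2[of p d "(1 + \<epsilon>) * a"] p d a e by (meson not_le less_trans zero_less_one)
  then have "ennreal ((1 + \<epsilon>) * a) \<le> ennreal d"
    by (rule ennreal_leI)
  then show ?thesis
    unfolding M N a(1) d(1) using e a by (subst (asm) ennreal_mult) auto
qed

theorem theorem1p1:
  fixes p :: real
  assumes "1 < p"
  shows "(\<exists>\<epsilon>>0. \<forall>f\<in>Lp_space p.
            Lp_enorm p (centered_maximal f) \<ge> ennreal (1 + \<epsilon>) * Lp_norm p f) \<and>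
         (\<forall>\<^sub>F n in sequentially. gamma_seq n * p / (p - 1) > 1) \<and>
         (\<forall>n\<ge>1. gamma_seq n * p / (p - 1) \<ge> 1 \<longrightarrow>
            (\<exists>\<epsilon>\<ge>0.
               (1 + \<epsilon>) powr p =
                 1 + ((best_constant p - 1) / (best_constant p ^ n - 1)) powr p *
                     ((gamma_seq n * p / (p - 1)) powr (1 / p) - 1) powr p \<and>
               (gamma_seq n * p / (p - 1) > 1 \<longrightarrow> \<epsilon> > 0) \<and>
               (\<forall>f\<in>Lp_space p.
                  Lp_enorm p (centered_maximal f) \<ge> ennreal (1 + \<epsilon>) * Lp_norm p f)))"
proof -
  let ?A = "best_constant p"
  let ?c = "\<lambda>n. gamma_seq n * p / (p - 1)"
  define R where "R n = ((?A - 1) / (?A ^ n - 1)) powr p * (?c n powr (1 / p) - 1) powr p" for n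
  have A: "1 < ?A" by (rule best_constant_greater_1[OF assms])
  have large: "\<forall>\<^sub>F n in sequentially. ?c n > 1"
    using eventually_gamma_seq_greater[of "(p - 1) / p"] assms
    by (auto elim!: eventually_mono simp: field_simps)
  have step: "\<exists>\<epsilon>\<ge>0. (1 + \<epsilon>) powr p = 1 + R n \<and> (?c n > 1 \<longrightarrow> \<epsilon> > 0) \<and>
      (\<forall>f\<in>Lp_space p. Lp_enorm p (centered_maximal f) \<ge> ennreal (1 + \<epsilon>) * Lp_norm p f)"
    if n: "1 \<le> n" "1 \<le> ?c n" for n
  proof (intro exI conjI impI ballI)
    have R0: "0 \<le> R n" by (simp add: R_def)
    then show e0: "0 \<le> (1 + R n) powr (1 / p) - 1"
      using assms by (simp add: ge_one_powr_ge_zero)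
    show eq: "(1 + ((1 + R n) powr (1 / p) - 1)) powr p = 1 + R n"
      using R0 assms by (simp add: powr_powr)
    show "0 < (1 + R n) powr (1 / p) - 1" if "1 < ?c n"
    proof -
      have "1 < ?A ^ n" using A n by simp
      moreover have "1 < ?c n powr (1 / p)" using that assms by (intro gr_one_powr) auto
      ultimately have "0 < R n" using A by (simp add: R_def)
      then show ?thesis using assms by (simp add: gr_one_powr)
    qed
    show "ennreal (1 + ((1 + R n) powr (1 / p) - 1)) * Lp_norm p f \<le> Lp_enorm p (centered_maximal f)"
      if "f \<in> Lp_space p" for f
      using eq by (intro Lp_enorm_hl_max_ge[OF assms n(2) that e0]) (simp add: R_def)
  qed
  obtain n where "1 \<le> n" "1 < ?c n"
    using eventually_conj[OF large eventually_ge_at_top[of 1]] by (auto simp: eventually_sequentially)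
  then have "\<exists>\<epsilon>>0. \<forall>f\<in>Lp_space p. Lp_enorm p (centered_maximal f) \<ge> ennreal (1 + \<epsilon>) * Lp_norm p f"
    using step[of n] by (meson less_imp_le)
  with large step show ?thesis unfolding R_def by blast
qed

end
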